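(* Let $(X_k)_{k\ge 0}$ be a sequence of independent real-valued random variables on a probability space $(\Omega,\mathcal A,\mathbb P)$ satisfying one of the following: (polynomial case) there exist $\beta>0$ and $d>0$ with $\mathbb E|X_k|^\beta=\mathcal O(k^d)$; or (subexponential case) there exist $\beta>0$ and $\gamma\in(0,1)$ with $\mathbb E|X_k|^\beta=\mathcal O(2^{k^\gamma})$. Define, for $n\ge 1$, $$c_n=\begin{cases}1+\sqrt{\log n} & \text{in the polynomial case},\\ n^{-\gamma/2} & \text{in the subexponential case}.\end{cases}$$ Let $(a_k)_{k\ge 0}$ be a sequence of complex numbers such that $$\sum_{n\ge 1}\frac{\sqrt{\sum_{k\ge n}|a_k|^2}}{n\,c_n}<+\infty .$$ Then there exists a measurable set $\Omega_0$ with $\mathbb P(\Omega_0)=1$ such that for every $\omega\in\Omega_0$ there is a constant $C_\omega>0$ (depending on $\omega$ but not on $f$ or $\alpha$) such that for every $f\in B(\mathbb T)$ with $\int_{\mathbb T}f(t)\,dt=0$: for every $\alpha\in\mathbb R$ the series $$F(\alpha,\omega)-\mathbb E(F(\alpha,\cdot)):=\sum_{k=0}^\infty a_k\left[f(\alpha X_k(\omega))-\mathbb E(f(\alpha X_k))\right]$$ is well defined, the function $\alpha\mapsto F(\alpha,\omega)-\mathbb E(F(\alpha,\cdot))$ is continuous on $\mathbb R$, the series defining it converges uniformly in $\alpha$ on every compact subset of $\mathbb R$, and for all $\alpha\in\mathbb R$ $$|F(\alpha,\omega)-\mathbb E(F(\alpha,\cdot))|\le C_\omega\,|||f|||\,\sqrt{\log(|\alpha|+2)}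 .$$
   Context: $\mathbb T=\mathbb R/\mathbb Z$, and functions on $\mathbb T$ are identified with $1$-periodic functions on $\mathbb R$. $B(\mathbb T)$ is the set of functions $f:\mathbb T\to\mathbb C$ of the form $f(\alpha)=\sum_{j\in\mathbb Z}\hat f(j)\exp(2i\pi\alpha j)$ with $$|||f|||:=\sum_{j\in\mathbb Z}|\hat f(j)|\sqrt{\log(|j|+3)}<+\infty .$$ The expression $F(\alpha,\omega)-\mathbb E(F(\alpha,\cdot))$ is a notation for the centered series displayed in the claim (the uncentered series need not converge separately). The symbol $\mathcal O$ is understood as $k\to\infty$. The set $\Omega_0$ does not depend on $f$. *)

theory Defs
  imports "HOL-Probability.Probability" "HOL-Library.Landau_Symbols"
begin

text \<open>Functions on \<open>\<real>/\<int>\<close> are \<open>1\<close>-periodic functions on \<open>\<real>\<close>, and integration over \<open>\<real>/\<int>\<close> is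
  Lebesgue integration over \<open>[0,1]\<close>.\<close>

definition circle_integral :: "(real \<Rightarrow> complex) \<Rightarrow> complex" where
  "circle_integral f = (LINT t:{0..1}|lborel. f t)"

definition fourier_coeff :: "(real \<Rightarrow> complex) \<Rightarrow> int \<Rightarrow> complex" where
  "fourier_coeff f j = circle_integral (\<lambda>t. f t * exp (- (2 * \<i> * of_real pi * of_real t * of_int j)))"

definition B_space :: "(real \<Rightarrow> complex) set" where
  "B_space = {f. (\<forall>t. f (t + 1) = f t)
     \<and> (\<lambda>j::int. cmod (fourier_coeff f j) * sqrt (ln (real_of_int \<bar>j\<bar> + 3))) summable_on UNIV
     \<and> (\<forall>t. ((\<lambda>j::int. fourier_coeff f j * exp (2 * \<i> * of_real pi * of_real t * of_int j))
               has_sum f t) UNIV)}"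

definition B_norm :: "(real \<Rightarrow> complex) \<Rightarrow> real" where
  "B_norm f = (\<Sum>\<^sub>\<infinity>j::int. cmod (fourier_coeff f j) * sqrt (ln (real_of_int \<bar>j\<bar> + 3)))"

text \<open>\<open>\<bbbE>|X\<^sub>k|\<^sup>\<beta> = \<O>(g k)\<close> as \<open>k \<rightarrow> \<infinity>\<close>.  The Bochner integral of a non-integrable function is \<open>0\<close>,
  so finiteness of the moments (for all large \<open>k\<close>) has to be required separately.\<close>

definition moments_bigo ::
  "'w measure \<Rightarrow> (nat \<Rightarrow> 'w \<Rightarrow> real) \<Rightarrow> real \<Rightarrow> (nat \<Rightarrow> real) \<Rightarrow> bool" where
  "moments_bigo M X \<beta> g \<longleftrightarrow>
     (\<forall>\<^sub>F k in sequentially. integrable M (\<lambda>\<omega>. \<bar>X k \<omega>\<bar> powr \<beta>))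
     \<and> (\<lambda>k. \<integral>\<omega>. \<bar>X k \<omega>\<bar> powr \<beta> \<partial>M) \<in> O(g)"

text \<open>The condition \<open>(\<Sum>n\<ge>1. sqrt (\<Sum>k\<ge>n. |a\<^sub>k|\<^sup>2) / (n c\<^sub>n)) < \<infinity>\<close> with sums in \<open>[0,\<infinity>]\<close>: it
  forces the inner sums to be finite, which must be said explicitly because the real-valued sum
  of a divergent series is unspecified.\<close>

definition tail_condition :: "(nat \<Rightarrow> complex) \<Rightarrow> (nat \<Rightarrow> real) \<Rightarrow> bool" where
  "tail_condition a c \<longleftrightarrow>
     summable (\<lambda>k. (cmod (a k))\<^sup>2)
     \<and> (\<lambda>n. sqrt (\<Sum>k. (cmod (a (n + k)))\<^sup>2) / (real n * c n)) summable_on {1..}"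

definition centered_term ::
  "'w measure \<Rightarrow> (nat \<Rightarrow> 'w \<Rightarrow> real) \<Rightarrow> (nat \<Rightarrow> complex) \<Rightarrow> (real \<Rightarrow> complex)
     \<Rightarrow> 'w \<Rightarrow> real \<Rightarrow> nat \<Rightarrow> complex" where
  "centered_term M X a f \<omega> \<alpha> k =
     a k * (f (\<alpha> * X k \<omega>) - (\<integral>\<omega>'. f (\<alpha> * X k \<omega>') \<partial>M))"

definition centered_series ::
  "'w measure \<Rightarrow> (nat \<Rightarrow> 'w \<Rightarrow> real) \<Rightarrow> (nat \<Rightarrow> complex) \<Rightarrow> (real \<Rightarrow> complex)
     \<Rightarrow> 'w \<Rightarrow> real \<Rightarrow> complex" where
  "centered_series M X a f \<omega> \<alpha> = (\<Sum>k. centered_term M X a f \<omega> \<alpha> k)"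

end

theory Submission
  imports Defs
begin

text \<open>
  Truncating \<open>X\<^sub>k\<close> at \<open>exp (l k)\<close>, with \<open>l\<close> logarithmic in the polynomial case and of order
  \<open>k\<^sup>\<gamma>\<close> in the subexponential one, changes only finitely many terms almost surely
  (Borel-Cantelli) and the expectations by a summable amount.  For the truncated variables,
  Hoeffding's inequality and a union bound over all pairs \<open>p < n\<close> and over a grid of mesh
  \<open>exp (-2 l n)\<close>, fine enough for the Lipschitz constants, show that almost surely, for all
  \<open>p \<le> n\<close> and all real \<open>t\<close> simultaneously, the partial sum of
  \<open>a\<^sub>k (exp (i t X\<^sub>k) - \<bbbE> exp (i t X\<^sub>k))\<close> over \<open>p \<le> k < n\<close> is at most a random constant times
  \<open>(\<Sum>p\<le>k<n. |a\<^sub>k|\<^sup>2)\<^bsup>1/2\<^esup> (l n)\<^bsup>1/2\<^esup> (ln (|t| + 2))\<^bsup>1/2\<^esup>\<close>.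

  This is applied on blocks \<open>[N\<^sub>m, N\<^sub>m\<^sub>+\<^sub>1)\<close>, with \<open>N\<^sub>m\<close> doubly exponential in \<open>m\<close> in the polynomial
  case and \<open>N\<^sub>m = 2\<^sup>m\<close> in the subexponential case.  By Cauchy condensation (twice, respectively
  once) the hypothesis on \<open>a\<close> makes the block bounds summable.  Finally the bound is summed over
  the Fourier series of \<open>f\<close>, using \<open>ln (|2\<pi>j\<alpha>| + 2) \<le> 9 ln (|j| + 3) ln (|\<alpha>| + 2)\<close>; the zeroth
  coefficient disappears by centering.
\<close>

subsection \<open>Centered exponentials\<close>

text \<open>The product of frequency and \<open>\<alpha>\<close> enters as one real parameter
  \<open>t\<close>, so that a bound uniform in \<open>t\<close> serves all Fourier modes and all
  \<open>\<alpha>\<close> at once.\<close>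

definition centered_iexp :: "'w measure \<Rightarrow> ('w \<Rightarrow> real) \<Rightarrow> real \<Rightarrow> 'w \<Rightarrow> complex" where
  "centered_iexp M Y t \<omega> = iexp (t * Y \<omega>) - (CLINT w|M. iexp (t * Y w))"

lemma cmod_iexp_diff_le: "cmod (iexp x - iexp y) \<le> \<bar>x - y\<bar>"
proof -
  have "iexp x - iexp y = iexp y * (iexp (x - y) - 1)"
    by (simp add: algebra_simps flip: exp_add)
  then have "cmod (iexp x - iexp y) = cmod (iexp (x - y) - 1)"
    by (simp add: norm_mult)
  also have "\<dots> \<le> \<bar>x - y\<bar>"
    using iexp_approx1[of "x - y" 0] by simp
  finally show ?thesis .
qed

context prob_space
begin

lemma integrable_iexp_mult:
  assumes "random_variable borel Y"
  shows "integrable M (\<lambda>w. iexp (t * Y w))"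
  by (rule integrable_const_bound[where B = 1]) (use assms in auto)

lemma cmod_centered_iexp_le:
  assumes "random_variable borel Y"
  shows "cmod (centered_iexp M Y t \<omega>) \<le> 2"
proof -
  have "cmod (CLINT w|M. iexp (t * Y w)) \<le> (\<integral>w. cmod (iexp (t * Y w)) \<partial>M)"
    by (rule integral_norm_bound)
  also have "\<dots> = 1" by (simp add: prob_space)
  finally show ?thesis
    unfolding centered_iexp_def by (intro norm_triangle_le_diff) simp
qed

lemma measurable_centered_iexp [measurable]:
  assumes [measurable]: "random_variable borel Y"
  shows "centered_iexp M Y t \<in> borel_measurable M"
  unfolding centered_iexp_def[abs_def] by measurable

lemma centered_iexp_uminus: "centered_iexp M (\<lambda>w. - Y w) t \<omega> = centered_iexp M Y (- t) \<omega>"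
  by (simp add: centered_iexp_def)

lemma continuous_centered_iexp:
  assumes [measurable]: "random_variable borel Y"
  shows "continuous_on A (\<lambda>t. centered_iexp M Y t \<omega>)"
proof -
  interpret D: real_distribution "distr M borel Y"
    by (rule real_distribution_distr) simp
  \<comment> \<open>The mean is the characteristic function of the law of \<open>Y\<close>, whose
    continuity is known.\<close>
  have "(CLINT w|M. iexp (t * Y w)) = char (distr M borel Y) t" for t
    unfolding char_def by (subst integral_distr) auto
  moreover have "continuous_on A (char (distr M borel Y))"
    using D.isCont_char by (intro continuous_at_imp_continuous_on) auto
  ultimately show ?thesis
    unfolding centered_iexp_def by (auto intro!: continuous_intros)
qed

text \<open>The random exponential and its mean are both \<open>R\<close>-Lipschitz in the
  frequency, whence the factor 2. This carries bounds from grid points to the frequencies in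
  between.\<close>

lemma centered_iexp_lipschitz:
  assumes [measurable]: "random_variable borel Y" and R: "\<And>w. \<bar>Y w\<bar> \<le> R"
  shows "cmod (centered_iexp M Y t \<omega> - centered_iexp M Y s \<omega>) \<le> 2 * R * \<bar>t - s\<bar>"
proof -
  have le: "cmod (iexp (t * Y w) - iexp (s * Y w)) \<le> R * \<bar>t - s\<bar>" for w
  proof -
    have "cmod (iexp (t * Y w) - iexp (s * Y w)) \<le> \<bar>t * Y w - s * Y w\<bar>"
      by (rule cmod_iexp_diff_le)
    also have "\<dots> = \<bar>Y w\<bar> * \<bar>t - s\<bar>"
      by (simp add: abs_mult[symmetric] algebra_simps)
    also have "\<dots> \<le> R * \<bar>t - s\<bar>"
      using R by (intro mult_right_mono) auto
    finally show ?thesis .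
  qed
  have "cmod ((CLINT w|M. iexp (t * Y w)) - (CLINT w|M. iexp (s * Y w)))
      = cmod (CLINT w|M. iexp (t * Y w) - iexp (s * Y w))"
    using Bochner_Integration.integral_diff[OF integrable_iexp_mult[OF assms(1), of t]
        integrable_iexp_mult[OF assms(1), of s]] by simp
  also have "\<dots> \<le> (\<integral>w. cmod (iexp (t * Y w) - iexp (s * Y w)) \<partial>M)"
    by (rule integral_norm_bound)
  also have "\<dots> \<le> (\<integral>w. R * \<bar>t - s\<bar> \<partial>M)"
    by (intro integral_mono le integrable_norm Bochner_Integration.integrable_diff
          integrable_iexp_mult) auto
  also have "\<dots> = R * \<bar>t - s\<bar>" by (simp add: prob_space)
  finally have "cmod ((CLINT w|M. iexp (t * Y w)) - (CLINT w|M. iexp (s * Y w))) \<le> R * \<bar>t - s\<bar>" .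
  moreover have "centered_iexp M Y t \<omega> - centered_iexp M Y s \<omega>
      = (iexp (t * Y \<omega>) - iexp (s * Y \<omega>))
        - ((CLINT w|M. iexp (t * Y w)) - (CLINT w|M. iexp (s * Y w)))"
    by (simp add: centered_iexp_def)
  ultimately show ?thesis
    using norm_triangle_le_diff[OF add_mono[OF le[of \<omega>]]] by fastforce
qed

text \<open>Hoeffding's inequality for real parts lying in intervals of length
  \<open>2 * cmod (a k)\<close>. The squared lengths add up to four times the sum of squares, by
  which the exponent is divided, so that \<open>r\<^sup>2 / 2\<close> remains.\<close>

lemma prob_Re_sum_centered_iexp_ge:
  fixes a :: "nat \<Rightarrow> complex"
  assumes indep: "indep_vars (\<lambda>_. borel) Y UNIV" and fin: "finite I"
    and pos: "(\<Sum>k\<in>I. (cmod (a k))\<^sup>2) > 0" and r: "r \<ge> 0"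
  shows "prob {\<omega> \<in> space M. \<bar>Re (\<Sum>k\<in>I. a k * centered_iexp M (Y k) t \<omega>)\<bar>
           \<ge> r * sqrt (\<Sum>k\<in>I. (cmod (a k))\<^sup>2)} \<le> 2 * exp (- (r\<^sup>2 / 2))"
proof -
  have rv: "random_variable borel (Y k)" for k
    using indep unfolding indep_vars_def by auto
  define Z where "Z k = (\<lambda>w. Re (a k * iexp (t * Y k w)))" for k
  have bd: "\<bar>Z k w\<bar> \<le> cmod (a k)" for k w
  proof -
    have "\<bar>Z k w\<bar> \<le> cmod (a k * iexp (t * Y k w))"
      unfolding Z_def by (rule abs_Re_le_cmod)
    then show ?thesis by (simp add: norm_mult)
  qed
  have ind: "indep_vars (\<lambda>_. borel) Z I"
    unfolding Z_def
    by (rule indep_vars_compose2[OF indep_vars_subset[OF indep]]) auto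
  interpret Hoeffding_ineq M I Z "\<lambda>k. - cmod (a k)" "\<lambda>k. cmod (a k)" "\<Sum>k\<in>I. expectation (Z k)"
  proof unfold_locales
    show "AE x in M. Z i x \<in> {- cmod (a i)..cmod (a i)}" for i
      using bd[of i] by (auto simp: abs_le_iff minus_le_iff)
  qed (use fin ind in auto)
  have E: "expectation (Z k) = Re (a k * (CLINT w|M. iexp (t * Y k w)))" for k
  proof -
    have "integrable M (\<lambda>w. a k * iexp (t * Y k w))"
      using integrable_iexp_mult[OF rv] by (intro integrable_mult_right) auto
    then have "expectation (Z k) = Re (CLINT w|M. a k * iexp (t * Y k w))"
      unfolding Z_def by (rule integral_Re)
    then show ?thesis by simp
  qed
  have eq: "Re (\<Sum>k\<in>I. a k * centered_iexp M (Y k) t \<omega>)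
      = (\<Sum>k\<in>I. Z k \<omega>) - (\<Sum>k\<in>I. expectation (Z k))" for \<omega>
    unfolding Re_sum sum_subtractf[symmetric]
  proof (rule sum.cong[OF refl])
    fix k
    have "a k * centered_iexp M (Y k) t \<omega>
        = a k * iexp (t * Y k \<omega>) - a k * (CLINT w|M. iexp (t * Y k w))"
      by (simp add: centered_iexp_def right_diff_distrib)
    then show "Re (a k * centered_iexp M (Y k) t \<omega>) = Z k \<omega> - expectation (Z k)"
      unfolding E by (simp only: Z_def minus_complex.sel)
  qed
  have s: "(\<Sum>k\<in>I. (cmod (a k) - - cmod (a k))\<^sup>2) = 4 * (\<Sum>k\<in>I. (cmod (a k))\<^sup>2)"
    by (simp add: sum_distrib_left power2_eq_square)
  have "prob {\<omega> \<in> space M. \<bar>(\<Sum>k\<in>I. Z k \<omega>) - (\<Sum>k\<in>I. expectation (Z k))\<bar>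
           \<ge> r * sqrt (\<Sum>k\<in>I. (cmod (a k))\<^sup>2)}
     \<le> 2 * exp (-2 * (r * sqrt (\<Sum>k\<in>I. (cmod (a k))\<^sup>2))\<^sup>2 / (\<Sum>k\<in>I. (cmod (a k) - - cmod (a k))\<^sup>2))"
    by (rule Hoeffding_ineq_abs_ge) (use r pos s in \<open>auto intro!: mult_nonneg_nonneg sum_nonneg\<close>)
  also have "-2 * (r * sqrt (\<Sum>k\<in>I. (cmod (a k))\<^sup>2))\<^sup>2 / (\<Sum>k\<in>I. (cmod (a k) - - cmod (a k))\<^sup>2)
      = - (r\<^sup>2 / 2)"
    unfolding s using pos by (simp add: power_mult_distrib field_simps)
  finally show ?thesis
    unfolding eq .
qed

text \<open>The usual Borel-Cantelli lemma, transported along an injection of the index type into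
  the naturals; it is applied to triples of indices.\<close>

lemma borel_cantelli_countable:
  fixes E :: "'i :: countable \<Rightarrow> 'a set"
  assumes E: "\<And>i. E i \<in> events" and le: "\<And>i. prob (E i) \<le> b i" and b: "b summable_on UNIV"
  shows "AE \<omega> in M. finite {i. \<omega> \<in> E i}"
proof -
  \<comment> \<open>Outside the range of \<open>to_nat\<close> the event is empty, so
    \<open>from_nat\<close> only matters where it inverts \<open>to_nat\<close>.\<close>
  define A where "A n = (if n \<in> range (to_nat :: 'i \<Rightarrow> nat) then E (from_nat n) else {})" for n
  have "(\<lambda>i. b (from_nat (to_nat i))) summable_on (UNIV :: 'i set)"
    using b by simp
  then have "(\<lambda>n. b (from_nat n)) summable_on range (to_nat :: 'i \<Rightarrow> nat)"
    by (subst summable_on_reindex) (auto simp: o_def)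
  then have "(\<lambda>n. if n \<in> range (to_nat :: 'i \<Rightarrow> nat) then b (from_nat n) else 0) summable_on UNIV"
    by (rule summable_on_cong_neutral[THEN iffD1, rotated -1]) auto
  then have "summable (\<lambda>n. if n \<in> range (to_nat :: 'i \<Rightarrow> nat) then b (from_nat n) else 0)"
    by (rule summable_on_UNIV_nonneg_real_iff[THEN iffD1, rotated])
      (use order_trans[OF measure_nonneg le] in auto)
  then have "summable (\<lambda>n. prob (A n))"
    by (rule summable_comparison_test'[of _ 0]) (use le in \<open>auto simp: A_def\<close>)
  then have "AE \<omega> in M. eventually (\<lambda>n. \<omega> \<in> space M - A n) sequentially"
    by (intro borel_cantelli_AE1) (use E in \<open>auto simp: A_def emeasure_eq_measure\<close>)
  then show ?thesis
  proof eventually_elim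
    case (elim \<omega>)
    then obtain n0 where n0: "\<And>n. n \<ge> n0 \<Longrightarrow> \<omega> \<notin> A n"
      by (auto simp: eventually_sequentially)
    have "to_nat i < n0" if "\<omega> \<in> E i" for i
      using n0[of "to_nat i"] that by (force simp: A_def)
    then have "to_nat ` {i. \<omega> \<in> E i} \<subseteq> {..<n0}" by auto
    then show "finite {i. \<omega> \<in> E i}"
      by (metis finite_imageD finite_lessThan finite_subset inj_on_subset inj_to_nat subset_UNIV)
  qed
qed

end

subsection \<open>Almost sure bounds for random trigonometric polynomials\<close>

text \<open>Since \<open>p < n\<close>, the level \<open>l\<close> dominates both
  \<open>ln (p + 2)\<close> and \<open>ln (n + 2)\<close>. Hence \<open>4 * l\<close> pays for an
  inverse square in each of \<open>p\<close> and \<open>n\<close>, and the other logarithm for one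
  in \<open>i\<close>.\<close>

lemma exp_mult_le_inverse_powers:
  fixes l :: real
  assumes "ln (real n + 2) \<le> l" and pn: "p < n"
  shows "exp (- (4 * (l + ln (real i + 2))))
    \<le> (1 / (real p + 1)\<^sup>2) * ((1 / (real n + 1)\<^sup>2) * (1 / (real i + 1)\<^sup>2))"
proof -
  have e: "exp (- (2 * ln (real m + 2))) \<le> 1 / (real m + 1)\<^sup>2" for m
  proof -
    have "exp (- (2 * ln (real m + 2))) = 1 / (real m + 2)\<^sup>2"
      by (simp add: exp_minus exp_double divide_inverse)
    also have "\<dots> \<le> 1 / (real m + 1)\<^sup>2"
      by (intro divide_left_mono power_mono mult_pos_pos zero_less_power) auto
    finally show ?thesis .
  qed
  have i0: "ln (real i + 2) \<ge> 0" by simp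
  have p0: "ln (real p + 2) \<le> ln (real n + 2)" using pn by simp
  have "- (4 * (l + x)) \<le> - (2 * z) + (- (2 * y) + - (2 * x))" if "y \<le> l" "z \<le> y" "0 \<le> x" for x y z :: real
    using that by (simp add: algebra_simps)
  from this[OF assms(1) p0 i0] have "exp (- (4 * (l + ln (real i + 2))))
     \<le> exp (- (2 * ln (real p + 2)) + (- (2 * ln (real n + 2)) + - (2 * ln (real i + 2))))"
    by (rule exp_le_cancel_iff[THEN iffD2])
  also have "\<dots> = exp (- (2 * ln (real p + 2))) * (exp (- (2 * ln (real n + 2))) * exp (- (2 * ln (real i + 2))))"
    by (simp only: exp_add)
  also have "\<dots> \<le> (1 / (real p + 1)\<^sup>2) * ((1 / (real n + 1)\<^sup>2) * (1 / (real i + 1)\<^sup>2))"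
    by (intro mult_mono e) auto
  finally show ?thesis .
qed

lemma summable_on_inverse_squares_triple:
  "(\<lambda>(p, n, i). 2 * ((1 / (real p + 1)\<^sup>2) * ((1 / (real n + 1)\<^sup>2) * (1 / (real i + 1)\<^sup>2))))
     summable_on (UNIV :: (nat \<times> nat \<times> nat) set)"
proof -
  define g :: "nat \<Rightarrow> real" where "g = (\<lambda>n. 1 / (real n + 1)\<^sup>2)"
  have "summable (\<lambda>n. 1 / (real (Suc n))\<^sup>2)"
    using inverse_power_summable[of 2, where ?'a = real]
    by (subst summable_Suc_iff) (simp add: inverse_eq_divide)
  then have "summable g" by (simp add: g_def add.commute)
  then have "summable (\<lambda>n. norm (g n))" by (simp add: g_def)
  then obtain s where s: "(g has_sum s) UNIV"
    using norm_summable_imp_has_sum[of g] \<open>summable g\<close> summable_sums by blast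
  have g0: "g n \<ge> 0" for n by (simp add: g_def)
  have "(\<lambda>(n, i). g n * g i) summable_on (UNIV \<times> UNIV)"
    by (rule summable_on_SigmaI[where g = "\<lambda>n. g n * s"])
      (use s g0 in \<open>auto intro!: has_sum_cmult_right summable_on_cmult_left mult_nonneg_nonneg
         intro: has_sum_imp_summable\<close>)
  then obtain r where r: "((\<lambda>(n, i). g n * g i) has_sum r) UNIV"
    by (auto simp: summable_on_def)
  have "(\<lambda>(p, q). g p * (case q of (n, i) \<Rightarrow> g n * g i)) summable_on (UNIV \<times> UNIV)"
    by (rule summable_on_SigmaI[where g = "\<lambda>n. g n * r"])
      (use s r g0 in \<open>auto intro!: has_sum_cmult_right summable_on_cmult_left mult_nonneg_nonneg
         intro: has_sum_imp_summable\<close>)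
  then have "(\<lambda>q. 2 * (case q of (p, n, i) \<Rightarrow> g p * (g n * g i))) summable_on UNIV"
    by (intro summable_on_cmult_right) (simp add: case_prod_beta')
  then show ?thesis by (simp add: g_def case_prod_beta')
qed

section \<open>Almost sure bounds: on a grid, at all frequencies, then without boundedness\<close>

context prob_space
begin

text \<open>The constant \<open>sqrt 8\<close> gives the deviation probability \<open>2 exp (-4 (l n + ln (i + 2)))\<close>, which
  is summable over all triples \<open>(p, n, i)\<close> with \<open>p < n\<close>.\<close>
lemma AE_Re_sum_bound_on_grid:
  fixes a :: "nat \<Rightarrow> complex" and \<delta> l :: "nat \<Rightarrow> real"
  assumes indep: "indep_vars (\<lambda>_. borel) Y UNIV"
    and l: "\<And>n. ln (real n + 2) \<le> l n"
  shows "AE \<omega> in M. \<exists>C\<ge>0. \<forall>p n i. p < n \<longrightarrow>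
    \<bar>Re (\<Sum>k=p..<n. a k * centered_iexp M (Y k) (real i * \<delta> n) \<omega>)\<bar>
      \<le> C * (L2_set (\<lambda>k. cmod (a k)) {p..<n} * sqrt (l n + ln (real i + 2)))"
proof -
  have rv[measurable]: "random_variable borel (Y k)" for k
    using indep unfolding indep_vars_def by auto
  define S where "S = (\<lambda>(p, n, i) \<omega>. \<bar>Re (\<Sum>k=p..<n. a k * centered_iexp M (Y k) (real i * \<delta> n) \<omega>)\<bar>)"
  define D where "D = (\<lambda>(p, n, i). L2_set (\<lambda>k. cmod (a k)) {p..<n} * sqrt (l n + ln (real i + 2)))"
  \<comment> \<open>Hoeffding's inequality is applied with a positive sum of squares; ranges on
    which all coefficients vanish are kept out of the events and treated separately.\<close>
  define good where "good = (\<lambda>(p, n, i :: nat). p < n \<and> L2_set (\<lambda>k. cmod (a k)) {p..<n} > 0)"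
  define E where "E q = {\<omega> \<in> space M. good q \<and> S q \<omega> \<ge> sqrt 8 * D q}" for q
  have l0: "l n > 0" for n
  proof -
    have "ln (real n + 2) > 0" by simp
    with l[of n] show ?thesis by linarith
  qed
  have pos: "l n + ln (real i + 2) > 0" for n i
    using l0[of n] by (simp add: add_pos_nonneg)
  have "AE \<omega> in M. finite {q. \<omega> \<in> E q}"
  proof (rule borel_cantelli_countable)
    have [measurable]: "S q \<in> borel_measurable M" for q
      by (cases q) (simp add: S_def)
    show "E q \<in> events" for q
      unfolding E_def by measurable
    show "prob (E q) \<le> (case q of (p, n, i) \<Rightarrow>
        2 * ((1 / (real p + 1)\<^sup>2) * ((1 / (real n + 1)\<^sup>2) * (1 / (real i + 1)\<^sup>2))))" for q
    proof (cases "good q")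
      case False
      then have "E q = {}" by (auto simp: E_def)
      then show ?thesis by (cases q) simp
    next
      case True
      obtain p n i where q: "q = (p, n, i)" by (cases q)
      define r where "r = sqrt (8 * (l n + ln (real i + 2)))"
      have pn: "p < n" and L: "L2_set (\<lambda>k. cmod (a k)) {p..<n} > 0"
        using True by (auto simp: good_def q)
      have r2: "r\<^sup>2 = 8 * (l n + ln (real i + 2))" and r0: "r \<ge> 0"
        using pos[of n i] by (auto simp: r_def)
      have "E q = {\<omega> \<in> space M. \<bar>Re (\<Sum>k=p..<n. a k * centered_iexp M (Y k) (real i * \<delta> n) \<omega>)\<bar>
          \<ge> r * sqrt (\<Sum>k=p..<n. (cmod (a k))\<^sup>2)}"
      proof -
        have "r = sqrt 8 * sqrt (l n + ln (real i + 2))"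
          unfolding r_def by (rule real_sqrt_mult)
        then have "r * L2_set (\<lambda>k. cmod (a k)) {p..<n} = sqrt 8 * D q"
          by (simp add: q D_def mult_ac)
        with True show ?thesis
          unfolding E_def L2_set_def by (simp add: q S_def)
      qed
      also have "prob \<dots> \<le> 2 * exp (- (r\<^sup>2 / 2))"
        using L r0 by (intro prob_Re_sum_centered_iexp_ge indep) (auto simp: L2_set_def)
      also have "- (r\<^sup>2 / 2) = - (4 * (l n + ln (real i + 2)))"
        by (simp only: r2)
      also have "2 * exp \<dots> \<le> 2 * ((1 / (real p + 1)\<^sup>2) * ((1 / (real n + 1)\<^sup>2) * (1 / (real i + 1)\<^sup>2)))"
        by (intro mult_left_mono exp_mult_le_inverse_powers l pn) auto
      finally show ?thesis by (simp add: q)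
    qed
  qed (rule summable_on_inverse_squares_triple)
  then show ?thesis
    using AE_space
  proof eventually_elim
    case (elim \<omega>)
    define F where "F = {q. \<omega> \<in> E q}"
    \<comment> \<open>\<open>sqrt 8\<close> serves all triples outside the finite exceptional set
      \<open>F\<close>; the sum of the ratios serves those in \<open>F\<close>.\<close>
    define C where "C = sqrt 8 + (\<Sum>q\<in>F. S q \<omega> / D q)"
    have fin: "finite F" using elim by (simp add: F_def)
    have S0: "S q \<omega> \<ge> 0" for q by (cases q) (simp add: S_def)
    have D0: "D q \<ge> 0" for q
      using pos by (cases q) (auto simp: D_def less_imp_le intro!: mult_nonneg_nonneg)
    have sum0: "0 \<le> (\<Sum>q\<in>F. S q \<omega> / D q)"
      using S0 D0 by (intro sum_nonneg) auto
    have C0: "C \<ge> 0" using sum0 by (simp add: C_def)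
    have le: "S q \<omega> \<le> C * D q" if "fst q < fst (snd q)" for q
    proof (cases "good q")
      case False
      obtain p n i where q: "q = (p, n, i)" by (cases q)
      have "L2_set (\<lambda>k. cmod (a k)) {p..<n} = 0"
        using False that L2_set_nonneg[of "\<lambda>k. cmod (a k)" "{p..<n}"] by (simp add: good_def q)
      then have "a k = 0" if "k \<in> {p..<n}" for k
        using that by (simp add: L2_set_eq_0_iff)
      then have "S q \<omega> = 0" by (simp add: S_def q)
      then show ?thesis using C0 D0 by simp
    next
      case True
      then have Dp: "D q > 0"
        using pos by (cases q) (auto simp: good_def D_def)
      show ?thesis
      proof (cases "q \<in> F")
        case True
        have "S q \<omega> / D q \<le> (\<Sum>q\<in>F. S q \<omega> / D q)"
          using S0 D0 by (intro member_le_sum True fin) auto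
        also have "\<dots> \<le> C" by (simp add: C_def)
        finally show ?thesis using Dp by (simp add: field_simps)
      next
        case False
        then have "S q \<omega> \<le> sqrt 8 * D q"
          using \<open>good q\<close> elim by (auto simp: F_def E_def)
        also have "\<dots> \<le> C * D q"
          using D0 sum0 by (intro mult_right_mono) (auto simp: C_def)
        finally show ?thesis .
      qed
    qed
    show ?case
      using C0 le[of "(p, n, i)" for p n i] by (intro exI[of _ C]) (auto simp: S_def D_def)
  qed
qed

text \<open>Each frequency is moved to its left neighbour on the grid of mesh
  \<open>exp (- (2 * l n))\<close>. One factor \<open>exp (l n)\<close> pays for the Lipschitz
  constants and one for the square root of the number of terms, so the error is a multiple of the
  \<open>L2_set\<close> norm. The grid index costs at most \<open>ln (t + 2) + 2 * l n\<close> in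
  the logarithm.\<close>

lemma AE_Re_sum_bound_nonneg:
  fixes a :: "nat \<Rightarrow> complex" and l :: "nat \<Rightarrow> real"
  assumes indep: "indep_vars (\<lambda>_. borel) Y UNIV"
    and l: "\<And>n. ln (real n + 2) \<le> l n" and mono: "mono l"
    and Y: "\<And>k w. \<bar>Y k w\<bar> \<le> exp (l k)"
  shows "AE \<omega> in M. \<exists>C\<ge>0. \<forall>p n t. p \<le> n \<longrightarrow> t \<ge> 0 \<longrightarrow>
    \<bar>Re (\<Sum>k=p..<n. a k * centered_iexp M (Y k) t \<omega>)\<bar>
      \<le> C * (L2_set (\<lambda>k. cmod (a k)) {p..<n} * sqrt (l n) * sqrt (ln (t + 2)))"
  using AE_Re_sum_bound_on_grid[OF indep l, of a "\<lambda>n. exp (- (2 * l n))"]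
proof eventually_elim
  case (elim \<omega>)
  have rv: "random_variable borel (Y k)" for k
    using indep unfolding indep_vars_def by auto
  obtain C where C0: "C \<ge> 0" and C: "\<And>p n i. p < n \<Longrightarrow>
    \<bar>Re (\<Sum>k=p..<n. a k * centered_iexp M (Y k) (real i * exp (- (2 * l n))) \<omega>)\<bar>
      \<le> C * (L2_set (\<lambda>k. cmod (a k)) {p..<n} * sqrt (l n + ln (real i + 2)))"
    using elim by auto
  have ln2: "ln 2 \<ge> (1 / 2 :: real)" using ln2_ge_two_thirds by simp
  have l2: "l n \<ge> 1 / 2" for n
  proof -
    have "ln 2 \<le> ln (real n + 2)" by simp
    then show ?thesis using ln2 l[of n] by linarith
  qed
  \<comment> \<open>\<open>C * sqrt 8\<close> comes from the grid point, \<open>4\<close> from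
    moving \<open>t\<close> to it.\<close>
  have main: "\<bar>Re (\<Sum>k=p..<n. a k * centered_iexp M (Y k) t \<omega>)\<bar>
      \<le> (C * sqrt 8 + 4) * (L2_set (\<lambda>k. cmod (a k)) {p..<n} * sqrt (l n) * sqrt (ln (t + 2)))"
    if pn: "p < n" and t: "t \<ge> 0" for p n t
  proof -
    define \<sigma> where "\<sigma> = L2_set (\<lambda>k. cmod (a k)) {p..<n}"
    define \<delta> where "\<delta> = exp (- (2 * l n))"
    define i where "i = nat \<lfloor>t / \<delta>\<rfloor>"
    define L where "L = ln (t + 2)"
    have \<sigma>0: "\<sigma> \<ge> 0" by (simp add: \<sigma>_def)
    have d0: "\<delta> > 0" by (simp add: \<delta>_def)
    have L2: "L \<ge> 1 / 2"
    proof -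
      have "ln 2 \<le> ln (t + 2)" using t by simp
      then show ?thesis using ln2 by (simp add: L_def)
    qed
    have ri: "real i = of_int \<lfloor>t / \<delta>\<rfloor>" using t d0 by (simp add: i_def)
    have i1: "real i \<le> t / \<delta>" and i2: "t / \<delta> \<le> real i + 1"
      unfolding ri by linarith+
    have td: "\<bar>t - real i * \<delta>\<bar> \<le> \<delta>"
      using i1 i2 d0 by (simp add: field_simps abs_le_iff)
    define S where "S t = (\<Sum>k=p..<n. a k * centered_iexp M (Y k) t \<omega>)" for t
    have "cmod (S t - S (real i * \<delta>)) \<le> 2 * \<sigma>"
    proof -
      have "cmod (S t - S (real i * \<delta>))
        \<le> (\<Sum>k=p..<n. cmod (a k) * cmod (centered_iexp M (Y k) t \<omega> - centered_iexp M (Y k) (real i * \<delta>) \<omega>))"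
        unfolding S_def sum_subtractf[symmetric] right_diff_distrib[symmetric]
        by (rule sum_norm_le) (simp add: norm_mult)
      also have "\<dots> \<le> (\<Sum>k=p..<n. cmod (a k) * (2 * exp (l n) * \<delta>))"
      proof (intro sum_mono mult_left_mono)
        fix k assume k: "k \<in> {p..<n}"
        have "cmod (centered_iexp M (Y k) t \<omega> - centered_iexp M (Y k) (real i * \<delta>) \<omega>)
          \<le> 2 * exp (l k) * \<bar>t - real i * \<delta>\<bar>"
          by (rule centered_iexp_lipschitz[OF rv Y])
        also have "\<dots> \<le> 2 * exp (l n) * \<delta>"
          using monoD[OF mono, of k n] k td by (intro mult_mono) auto
        finally show "cmod (centered_iexp M (Y k) t \<omega> - centered_iexp M (Y k) (real i * \<delta>) \<omega>)
          \<le> 2 * exp (l n) * \<delta>" .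
      qed auto
      \<comment> \<open>The factor 1 is inserted for Cauchy-Schwarz, which produces the square root
        of the number of terms.\<close>
      also have "\<dots> = 2 * (exp (l n) * \<delta>) * (\<Sum>k=p..<n. \<bar>cmod (a k)\<bar> * \<bar>1\<bar>)"
        by (simp add: sum_distrib_left mult_ac)
      also have "\<dots> \<le> 2 * (exp (l n) * \<delta>) * (\<sigma> * L2_set (\<lambda>k. 1) {p..<n})"
        unfolding \<sigma>_def by (intro mult_left_mono L2_set_mult_ineq) (use d0 in auto)
      also have "\<dots> \<le> 2 * (exp (l n) * \<delta>) * (\<sigma> * exp (l n))"
      proof -
        have "L2_set (\<lambda>k. 1 :: real) {p..<n} = sqrt (real (n - p))"
          by (simp add: L2_set_def)
        also have "\<dots> \<le> sqrt ((real n + 2)\<^sup>2)"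
          by (intro real_sqrt_le_mono) (simp add: power2_eq_square field_simps of_nat_diff pn less_imp_le)
        also have "\<dots> = exp (ln (real n + 2))" by simp
        also have "\<dots> \<le> exp (l n)" using l[of n] by (simp only: exp_le_cancel_iff)
        finally show ?thesis using \<sigma>0 d0 by (intro mult_left_mono) auto
      qed
      also have "\<dots> = 2 * \<sigma>"
        by (simp add: \<delta>_def mult_ac flip: exp_add)
      finally show ?thesis .
    qed
    then have 1: "\<bar>Re (S t)\<bar> \<le> \<bar>Re (S (real i * \<delta>))\<bar> + 2 * \<sigma>"
      using abs_Re_le_cmod[of "S t - S (real i * \<delta>)"] by simp
    have "\<bar>Re (S (real i * \<delta>))\<bar> \<le> C * (\<sigma> * sqrt (l n + ln (real i + 2)))"
      using C[OF pn, of i] by (simp add: S_def \<sigma>_def \<delta>_def)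
    also have "\<dots> \<le> C * (\<sigma> * sqrt (8 * (l n * L)))"
    proof -
      have "real i + 2 \<le> (t + 2) * exp (2 * l n)"
      proof -
        have "real i + 2 \<le> t * exp (2 * l n) + 2 * 1"
          using i1 by (simp add: \<delta>_def exp_minus field_simps)
        also have "\<dots> \<le> t * exp (2 * l n) + 2 * exp (2 * l n)"
          using l2[of n] by (intro add_left_mono mult_left_mono) auto
        finally show ?thesis by (simp add: algebra_simps)
      qed
      then have "ln (real i + 2) \<le> ln ((t + 2) * exp (2 * l n))"
        by simp
      also have "\<dots> = L + 2 * l n"
        using t by (simp add: L_def ln_mult)
      finally have 2: "l n + ln (real i + 2) \<le> 3 * l n + L" by simp
      have "(l n - 1/2) * (L - 1/2) \<ge> 0"
        using l2[of n] L2 by (intro mult_nonneg_nonneg) auto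
      \<comment> \<open>Six times the first product plus twice the second equals
        \<open>8 * (l n * L) - 3 * l n - L\<close>.\<close>
      moreover have "l n * (L - 1/2) \<ge> 0" "L * (l n - 1/2) \<ge> 0"
        using l2[of n] L2 by (auto intro!: mult_nonneg_nonneg)
      ultimately have "3 * l n + L \<le> 8 * (l n * L)"
        by (simp add: algebra_simps)
      with 2 have "sqrt (l n + ln (real i + 2)) \<le> sqrt (8 * (l n * L))"
        by simp
      then show ?thesis using C0 \<sigma>0 by (intro mult_left_mono) auto
    qed
    also have "\<dots> = C * sqrt 8 * (\<sigma> * sqrt (l n) * sqrt L)"
      by (simp add: real_sqrt_mult)
    finally have 3: "\<bar>Re (S (real i * \<delta>))\<bar> \<le> C * sqrt 8 * (\<sigma> * sqrt (l n) * sqrt L)" .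
    \<comment> \<open>Both factors are at least 1/2, so the error \<open>2 * \<sigma>\<close> is at
      most \<open>4 * \<sigma> * sqrt (l n) * sqrt L\<close>.\<close>
    have "1 / 4 \<le> l n * L"
      using mult_mono[of "1/2" "l n" "1/2" L] l2[of n] L2 by simp
    then have "sqrt (1 / 4) \<le> sqrt (l n * L)" by (rule real_sqrt_le_mono)
    then have "1 / 2 \<le> sqrt (l n) * sqrt L"
      by (simp add: real_sqrt_mult real_sqrt_divide)
    then have "\<sigma> * (1 / 2) \<le> \<sigma> * (sqrt (l n) * sqrt L)"
      using \<sigma>0 by (rule mult_left_mono)
    with 1 3 show ?thesis
      by (simp add: S_def[symmetric] \<sigma>_def[symmetric] L_def[symmetric] algebra_simps)
  qed
  show ?case
  proof (intro exI[of _ "C * sqrt 8 + 4"] conjI allI impI)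
    fix p n :: nat and t :: real
    assume "p \<le> n" "t \<ge> 0"
    then show "\<bar>Re (\<Sum>k=p..<n. a k * centered_iexp M (Y k) t \<omega>)\<bar>
      \<le> (C * sqrt 8 + 4) * (L2_set (\<lambda>k. cmod (a k)) {p..<n} * sqrt (l n) * sqrt (ln (t + 2)))"
      using main[of p n t] by (cases "p = n") auto
  qed (use C0 in simp)
qed

lemma AE_sum_bound:
  fixes a :: "nat \<Rightarrow> complex" and l :: "nat \<Rightarrow> real"
  assumes indep: "indep_vars (\<lambda>_. borel) Y UNIV"
    and l: "\<And>n. ln (real n + 2) \<le> l n" and mono: "mono l"
    and Y: "\<And>k w. \<bar>Y k w\<bar> \<le> exp (l k)"
  shows "AE \<omega> in M. \<exists>C\<ge>0. \<forall>p n t. p \<le> n \<longrightarrow>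
    cmod (\<Sum>k=p..<n. a k * centered_iexp M (Y k) t \<omega>)
      \<le> C * (L2_set (\<lambda>k. cmod (a k)) {p..<n} * sqrt (l n) * sqrt (ln (\<bar>t\<bar> + 2)))"
proof -
  have indep': "indep_vars (\<lambda>_. borel) (\<lambda>k w. - Y k w) UNIV"
    by (rule indep_vars_compose2[OF indep]) auto
  have Y': "\<bar>- Y k w\<bar> \<le> exp (l k)" for k w using Y by simp
  note pos = AE_Re_sum_bound_nonneg[OF indep l mono Y]
    and neg = AE_Re_sum_bound_nonneg[OF indep' l mono Y']
  show ?thesis
    \<comment> \<open>multiplying \<open>a\<close> by \<open>-\<i>\<close> exchanges real and imaginary parts, negating \<open>Y\<close> reverses \<open>t\<close>\<close>
    using pos[of a] pos[of "\<lambda>k. - \<i> * a k"] neg[of a] neg[of "\<lambda>k. - \<i> * a k"]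
  proof eventually_elim
    case (elim \<omega>)
    define S where "S p n t = (\<Sum>k=p..<n. a k * centered_iexp M (Y k) t \<omega>)" for p n t
    define D where "D p n t = L2_set (\<lambda>k. cmod (a k)) {p..<n} * sqrt (l n) * sqrt (ln (t + 2))" for p n t
    have im: "(\<Sum>k=p..<n. - \<i> * a k * centered_iexp M (Y k) t \<omega>) = - \<i> * S p n t" for p n t
      by (simp add: S_def sum_distrib_left mult_ac)
    have nm: "cmod (- \<i> * a k) = cmod (a k)" for k by (simp add: norm_mult)
    obtain C1 where C1: "C1 \<ge> 0"
      "\<And>p n t. p \<le> n \<Longrightarrow> t \<ge> 0 \<Longrightarrow> \<bar>Re (S p n t)\<bar> \<le> C1 * D p n t"
      using elim(1) unfolding S_def D_def by blast
    obtain C2 where C2: "C2 \<ge> 0"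
      "\<And>p n t. p \<le> n \<Longrightarrow> t \<ge> 0 \<Longrightarrow> \<bar>Im (S p n t)\<bar> \<le> C2 * D p n t"
      using elim(2) unfolding im nm D_def by auto
    obtain C3 where C3: "C3 \<ge> 0"
      "\<And>p n t. p \<le> n \<Longrightarrow> t \<ge> 0 \<Longrightarrow> \<bar>Re (S p n (- t))\<bar> \<le> C3 * D p n t"
      using elim(3) unfolding centered_iexp_uminus S_def D_def by blast
    obtain C4 where C4: "C4 \<ge> 0"
      "\<And>p n t. p \<le> n \<Longrightarrow> t \<ge> 0 \<Longrightarrow> \<bar>Im (S p n (- t))\<bar> \<le> C4 * D p n t"
      using elim(4) unfolding centered_iexp_uminus im nm D_def by auto
    have l0: "l n \<ge> 0" for n
      using l[of n] ln_ge_zero[of "real n + 2"] by linarith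
    have "cmod (S p n t) \<le> (C1 + C2 + C3 + C4) * D p n \<bar>t\<bar>" if "p \<le> n" for p n t
    proof -
      have D0: "D p n \<bar>t\<bar> \<ge> 0" using l0 by (simp add: D_def)
      have "cmod (S p n t) \<le> \<bar>Re (S p n t)\<bar> + \<bar>Im (S p n t)\<bar>" by (rule cmod_le)
      moreover have "\<bar>Re (S p n t)\<bar> \<le> (C1 + C3) * D p n \<bar>t\<bar>"
        using C1(2)[OF that, of t] C3(2)[OF that, of "- t"] mult_nonneg_nonneg[OF C1(1) D0]
          mult_nonneg_nonneg[OF C3(1) D0]
        by (cases "t \<ge> 0") (auto simp: distrib_right)
      moreover have "\<bar>Im (S p n t)\<bar> \<le> (C2 + C4) * D p n \<bar>t\<bar>"
        using C2(2)[OF that, of t] C4(2)[OF that, of "- t"] mult_nonneg_nonneg[OF C2(1) D0]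
          mult_nonneg_nonneg[OF C4(1) D0]
        by (cases "t \<ge> 0") (auto simp: distrib_right)
      ultimately show ?thesis by (simp add: algebra_simps)
    qed
    then show ?case
      using C1(1) C2(1) C3(1) C4(1) unfolding S_def D_def
      by (intro exI[of _ "C1 + C2 + C3 + C4"]) auto
  qed
qed

text \<open>Truncation changes the exponentials only on the events \<open>A k\<close>. By
  Borel-Cantelli the pathwise change affects finitely many terms, and the means change by a summable
  amount; both go into \<open>\<rho>\<close>, which depends on the outcome but not on
  \<open>t\<close>.\<close>

lemma AE_sum_bound_truncated:
  fixes a :: "nat \<Rightarrow> complex" and l :: "nat \<Rightarrow> real"
  assumes indep: "indep_vars (\<lambda>_. borel) X UNIV"
    and l: "\<And>n. ln (real n + 2) \<le> l n" and mono: "mono l"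
    and tail: "summable (\<lambda>k. prob {\<omega> \<in> space M. \<bar>X k \<omega>\<bar> > exp (l k)})"
    and a: "\<And>k. cmod (a k) \<le> B"
  shows "AE \<omega> in M. \<exists>C\<ge>0. \<exists>\<rho>. summable \<rho> \<and> (\<forall>k. \<rho> k \<ge> 0) \<and> (\<forall>p n t. p \<le> n \<longrightarrow>
    cmod (\<Sum>k=p..<n. a k * centered_iexp M (X k) t \<omega>)
      \<le> C * (L2_set (\<lambda>k. cmod (a k)) {p..<n} * sqrt (l n) * sqrt (ln (\<bar>t\<bar> + 2))) + (\<Sum>k=p..<n. \<rho> k))"
proof -
  have rv[measurable]: "random_variable borel (X k)" for k
    using indep unfolding indep_vars_def by auto
  define A where "A k = {\<omega> \<in> space M. \<bar>X k \<omega>\<bar> > exp (l k)}" for k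
  \<comment> \<open>A Borel function of \<open>X k\<close> alone, so independence survives the
    truncation.\<close>
  define Y where "Y k w = (if \<bar>X k w\<bar> \<le> exp (l k) then X k w else 0)" for k w
  have A[measurable]: "A k \<in> events" for k unfolding A_def by measurable
  have indepY: "indep_vars (\<lambda>_. borel) Y UNIV"
    unfolding Y_def by (rule indep_vars_compose2[OF indep]) auto
  have rvY: "random_variable borel (Y k)" for k
    using indepY unfolding indep_vars_def by auto
  have Y: "\<bar>Y k w\<bar> \<le> exp (l k)" for k w by (simp add: Y_def)
  have diff: "cmod (iexp (t * X k w) - iexp (t * Y k w)) \<le> 2 * indicat_real (A k) w"
    if "w \<in> space M" for k w t
  proof (cases "w \<in> A k")
    case True
    have "cmod (iexp (t * X k w) - iexp (t * Y k w)) \<le> cmod (iexp (t * X k w)) + cmod (iexp (t * Y k w))"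
      by (rule norm_triangle_ineq4)
    also have "\<dots> = 2" by simp
    finally show ?thesis using True by simp
  next
    case False
    then have "Y k w = X k w" using that by (auto simp: A_def Y_def)
    then show ?thesis by simp
  qed
  have Ediff: "cmod ((CLINT w|M. iexp (t * X k w)) - (CLINT w|M. iexp (t * Y k w))) \<le> 2 * prob (A k)" for k t
  proof -
    have "cmod ((CLINT w|M. iexp (t * X k w)) - (CLINT w|M. iexp (t * Y k w)))
        = cmod (CLINT w|M. iexp (t * X k w) - iexp (t * Y k w))"
      using Bochner_Integration.integral_diff[OF integrable_iexp_mult[OF rv, of t k]
          integrable_iexp_mult[OF rvY, of t k]] by simp
    also have "\<dots> \<le> (\<integral>w. cmod (iexp (t * X k w) - iexp (t * Y k w)) \<partial>M)"
      by (rule integral_norm_bound)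
    also have "\<dots> \<le> (\<integral>w. 2 * indicat_real (A k) w \<partial>M)"
      by (intro integral_mono diff integrable_norm Bochner_Integration.integrable_diff
            integrable_iexp_mult rv rvY) (auto simp: emeasure_eq_measure)
    also have "\<dots> = 2 * prob (A k)" using A by simp
    finally show ?thesis .
  qed
  have "AE \<omega> in M. eventually (\<lambda>k. \<omega> \<in> space M - A k) sequentially"
    using tail by (intro borel_cantelli_AE1) (auto simp: A_def[symmetric] emeasure_eq_measure)
  with AE_sum_bound[OF indepY l mono Y, of a] show ?thesis
    using AE_space
  proof eventually_elim
    case (elim \<omega>)
    obtain C where C0: "C \<ge> 0" and C: "\<And>p n t. p \<le> n \<Longrightarrow>
      cmod (\<Sum>k=p..<n. a k * centered_iexp M (Y k) t \<omega>)
      \<le> C * (L2_set (\<lambda>k. cmod (a k)) {p..<n} * sqrt (l n) * sqrt (ln (\<bar>t\<bar> + 2)))"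
      using elim(1) by auto
    \<comment> \<open>Two exponentials differ by at most 2: the indicator accounts for the path, the
      probability for the mean.\<close>
    define \<rho> where "\<rho> k = B * (2 * indicat_real (A k) \<omega> + 2 * prob (A k))" for k
    have B0: "B \<ge> 0" using a[of 0] norm_ge_zero order_trans by blast
    have "\<forall>\<^sub>F k in sequentially. indicat_real (A k) \<omega> = 0"
      using elim(2) by eventually_elim auto
    then have "summable (\<lambda>k. indicat_real (A k) \<omega>)"
      by (subst summable_cong[where g = "\<lambda>_. 0"]) auto
    then have \<rho>: "summable \<rho>"
      unfolding \<rho>_def using tail by (intro summable_mult summable_add) (auto simp: A_def)
    have \<rho>0: "\<rho> k \<ge> 0" for k using B0 by (simp add: \<rho>_def)
    have diff_le: "cmod (a k * centered_iexp M (X k) t \<omega> - a k * centered_iexp M (Y k) t \<omega>) \<le> \<rho> k" for k t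
    proof -
      have "cmod (centered_iexp M (X k) t \<omega> - centered_iexp M (Y k) t \<omega>)
        = cmod ((iexp (t * X k \<omega>) - iexp (t * Y k \<omega>))
           - ((CLINT w|M. iexp (t * X k w)) - (CLINT w|M. iexp (t * Y k w))))"
        by (simp add: centered_iexp_def algebra_simps)
      also have "\<dots> \<le> 2 * indicat_real (A k) \<omega> + 2 * prob (A k)"
        by (intro norm_triangle_le_diff add_mono diff Ediff elim)
      finally show ?thesis
        unfolding right_diff_distrib[symmetric] norm_mult \<rho>_def
        by (intro mult_mono a B0) auto
    qed
    have "cmod (\<Sum>k=p..<n. a k * centered_iexp M (X k) t \<omega>)
      \<le> C * (L2_set (\<lambda>k. cmod (a k)) {p..<n} * sqrt (l n) * sqrt (ln (\<bar>t\<bar> + 2))) + (\<Sum>k=p..<n. \<rho> k)"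
      if "p \<le> n" for p n t
    proof -
      have "cmod ((\<Sum>k=p..<n. a k * centered_iexp M (X k) t \<omega>)
          - (\<Sum>k=p..<n. a k * centered_iexp M (Y k) t \<omega>)) \<le> (\<Sum>k=p..<n. \<rho> k)"
        unfolding sum_subtractf[symmetric] by (intro sum_norm_le diff_le)
      with C[OF that, of t] show ?thesis
        by (smt (verit) norm_triangle_sub)
    qed
    with C0 \<rho> \<rho>0 show ?case by blast
  qed
qed

end

subsection \<open>Summation over blocks and frequencies\<close>

text \<open>Allows terms without growth in \<open>t\<close>, such as tails of \<open>\<rho>\<close>,
  to be absorbed into multiples of the logarithmic factor.\<close>

lemma sqrt_ln_ge_half: "1 / 2 \<le> sqrt (ln (\<bar>t\<bar> + 2))" for t :: real
proof -
  have "1 / 4 \<le> ln (2 :: real)" using ln2_ge_two_thirds by simp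
  also have "\<dots> \<le> ln (\<bar>t\<bar> + 2)" by simp
  finally have "sqrt (1 / 4) \<le> sqrt (ln (\<bar>t\<bar> + 2))" by (rule real_sqrt_le_mono)
  then show ?thesis by (simp add: real_sqrt_divide)
qed

lemma L2_set_le_sqrt_suminf:
  fixes a :: "nat \<Rightarrow> complex"
  assumes "summable (\<lambda>k. (cmod (a k))\<^sup>2)" and "q \<le> p"
  shows "L2_set (\<lambda>k. cmod (a k)) {p..<n} \<le> sqrt (\<Sum>k. (cmod (a (q + k)))\<^sup>2)"
proof -
  have "(\<Sum>k=p..<n. (cmod (a k))\<^sup>2) \<le> (\<Sum>k=q..<q+n. (cmod (a k))\<^sup>2)"
    using assms(2) by (intro sum_mono2) auto
  also have "\<dots> = (\<Sum>k<n. (cmod (a (q + k)))\<^sup>2)"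
    using sum.shift_bounds_nat_ivl[of "\<lambda>k. (cmod (a k))\<^sup>2" 0 q n]
    by (simp add: add.commute atLeast0LessThan)
  also have "\<dots> \<le> (\<Sum>k. (cmod (a (q + k)))\<^sup>2)"
    using summable_ignore_initial_segment[OF assms(1), of q]
    by (intro sum_le_suminf) (auto simp: add.commute)
  finally show ?thesis
    unfolding L2_set_def by (rule real_sqrt_le_mono)
qed

text \<open>On a long range the hypothesis pairs the whole norm with the largest \<open>l n\<close>.
  Cutting at the points \<open>N m\<close> pairs the tail of the squares from \<open>N m\<close> on
  with \<open>l (N (Suc m))\<close> only, while the sums of \<open>\<rho>\<close> simply
  concatenate.\<close>

lemma sum_bound_over_blocks:
  fixes s :: "nat \<Rightarrow> complex" and a :: "nat \<Rightarrow> complex" and l \<rho> :: "nat \<Rightarrow> real" and N :: "nat \<Rightarrow> nat"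
  assumes bd: "\<And>p n. p \<le> n \<Longrightarrow>
      cmod (\<Sum>k=p..<n. s k) \<le> K * (L2_set (\<lambda>k. cmod (a k)) {p..<n} * sqrt (l n)) + (\<Sum>k=p..<n. \<rho> k)"
    and K: "K \<ge> 0" and a: "summable (\<lambda>k. (cmod (a k))\<^sup>2)"
    and mono: "mono l" and l0: "\<And>n. l n \<ge> 0" and N: "mono N"
    and "M0 \<le> M" "N M0 \<le> p" "p \<le> n" "n \<le> N M"
  shows "cmod (\<Sum>k=p..<n. s k)
    \<le> K * (\<Sum>m=M0..<M. sqrt (\<Sum>k. (cmod (a (N m + k)))\<^sup>2) * sqrt (l (N (Suc m)))) + (\<Sum>k=p..<n. \<rho> k)"
proof -
  define w where "w m = sqrt (\<Sum>k. (cmod (a (N m + k)))\<^sup>2) * sqrt (l (N (Suc m)))" for m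
  have T0: "(\<Sum>k. (cmod (a (q + k)))\<^sup>2) \<ge> 0" for q
    using summable_ignore_initial_segment[OF a, of q] by (intro suminf_nonneg) (auto simp: add.commute)
  have w0: "w m \<ge> 0" for m
    using T0 l0 by (simp add: w_def)
  have block: "cmod (\<Sum>k=p..<n. s k) \<le> K * w m + (\<Sum>k=p..<n. \<rho> k)"
    if "N m \<le> p" "p \<le> n" "n \<le> N (Suc m)" for p n m
  proof -
    have "L2_set (\<lambda>k. cmod (a k)) {p..<n} * sqrt (l n) \<le> w m"
      unfolding w_def using that
      by (intro mult_mono L2_set_le_sqrt_suminf a real_sqrt_le_mono monoD[OF mono])
        (auto simp: l0 T0)
    with bd[OF that(2)] K show ?thesis
      by (smt (verit) mult_left_mono)
  qed
  \<comment> \<open>The end points are quantified inside the induction, because a range crossing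
    \<open>N M\<close> is cut there and the hypothesis is applied to its first piece.\<close>
  have "\<forall>p n. N M0 \<le> p \<longrightarrow> p \<le> n \<longrightarrow> n \<le> N M \<longrightarrow>
      cmod (\<Sum>k=p..<n. s k) \<le> K * (\<Sum>m=M0..<M. w m) + (\<Sum>k=p..<n. \<rho> k)"
    using \<open>M0 \<le> M\<close>
  proof (induction M rule: dec_induct)
    case (step M)
    have sum: "(\<Sum>m=M0..<Suc M. w m) = (\<Sum>m=M0..<M. w m) + w M"
      using step(1) by simp
    have sum0: "(\<Sum>m=M0..<M. w m) \<ge> 0" using w0 by (simp add: sum_nonneg)
    show ?case
    proof (intro allI impI)
      fix p n assume p: "N M0 \<le> p" "p \<le> n" "n \<le> N (Suc M)"
      consider "n \<le> N M" | "N M \<le> p" | "p \<le> N M" "N M \<le> n" by linarith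
      then show "cmod (\<Sum>k=p..<n. s k) \<le> K * (\<Sum>m=M0..<Suc M. w m) + (\<Sum>k=p..<n. \<rho> k)"
      proof cases
        case 1
        then have "cmod (\<Sum>k=p..<n. s k) \<le> K * (\<Sum>m=M0..<M. w m) + (\<Sum>k=p..<n. \<rho> k)"
          using step p by blast
        then show ?thesis
          using mult_nonneg_nonneg[OF K w0[of M]] unfolding sum by (simp add: distrib_left)
      next
        case 2
        then show ?thesis
          using block[of M p n] p mult_nonneg_nonneg[OF K sum0] unfolding sum
          by (simp add: distrib_left)
      next
        case 3
        have "cmod (\<Sum>k=p..<N M. s k) \<le> K * (\<Sum>m=M0..<M. w m) + (\<Sum>k=p..<N M. \<rho> k)"
          using step p 3 by blast
        moreover have "cmod (\<Sum>k=N M..<n. s k) \<le> K * w M + (\<Sum>k=N M..<n. \<rho> k)"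
          using block[of M "N M" n] p 3 by blast
        moreover have "(\<Sum>k=p..<n. s k) = (\<Sum>k=p..<N M. s k) + (\<Sum>k=N M..<n. s k)"
          "(\<Sum>k=p..<n. \<rho> k) = (\<Sum>k=p..<N M. \<rho> k) + (\<Sum>k=N M..<n. \<rho> k)"
          using 3 by (simp_all add: sum.atLeastLessThan_concat)
        ultimately show ?thesis unfolding sum
          by (smt (verit) norm_triangle_ineq distrib_left)
      qed
    qed
  qed auto
  then show ?thesis
    using assms by (simp add: w_def)
qed

text \<open>Far out, the tails of the block weights and of \<open>\<rho>\<close> are both small.
  Measured against the logarithmic factor, the partial sums are thus Cauchy uniformly over all real
  \<open>t\<close>.\<close>

lemma uniformly_Cauchy_of_blocks:
  fixes s :: "nat \<Rightarrow> real \<Rightarrow> complex" and a :: "nat \<Rightarrow> complex" and l \<rho> :: "nat \<Rightarrow> real"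
    and N :: "nat \<Rightarrow> nat"
  assumes bd: "\<And>p n t. p \<le> n \<Longrightarrow> cmod (\<Sum>k=p..<n. s k t)
      \<le> C * (L2_set (\<lambda>k. cmod (a k)) {p..<n} * sqrt (l n) * sqrt (ln (\<bar>t\<bar> + 2))) + (\<Sum>k=p..<n. \<rho> k)"
    and C: "C \<ge> 0" and \<rho>: "summable \<rho>" and a: "summable (\<lambda>k. (cmod (a k))\<^sup>2)"
    and mono: "mono l" and l0: "\<And>n. l n \<ge> 0" and N: "strict_mono N"
    and w: "summable (\<lambda>m. sqrt (\<Sum>k. (cmod (a (N m + k)))\<^sup>2) * sqrt (l (N (Suc m))))"
    and \<epsilon>: "\<epsilon> > 0"
  shows "\<exists>p0. \<forall>p n t. p0 \<le> p \<longrightarrow> p \<le> n \<longrightarrow> cmod (\<Sum>k=p..<n. s k t) \<le> \<epsilon> * sqrt (ln (\<bar>t\<bar> + 2))"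
proof -
  define w' where "w' m = sqrt (\<Sum>k. (cmod (a (N m + k)))\<^sup>2) * sqrt (l (N (Suc m)))" for m
  \<comment> \<open>\<open>C + 1\<close> instead of \<open>C\<close> keeps the denominator positive
    when \<open>C = 0\<close>.\<close>
  have "\<epsilon> / (2 * (C + 1)) > 0" using C \<epsilon> by simp
  then obtain M0 where M0: "\<And>m n. m \<ge> M0 \<Longrightarrow> norm (sum w' {m..<n}) < \<epsilon> / (2 * (C + 1))"
    using w unfolding w'_def[symmetric] summable_Cauchy by blast
  have "\<epsilon> / 4 > 0" using \<epsilon> by simp
  then obtain p1 where p1: "\<And>m n. m \<ge> p1 \<Longrightarrow> norm (sum \<rho> {m..<n}) < \<epsilon> / 4"
    using \<rho> unfolding summable_Cauchy by blast
  have "cmod (\<Sum>k=p..<n. s k t) \<le> \<epsilon> * sqrt (ln (\<bar>t\<bar> + 2))"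
    if p: "max (N M0) p1 \<le> p" "p \<le> n" for p n t
  proof -
    define x where "x = sqrt (ln (\<bar>t\<bar> + 2))"
    have x: "1 / 2 \<le> x" using sqrt_ln_ge_half by (simp add: x_def)
    \<comment> \<open>A strictly increasing \<open>N\<close> dominates the identity, so the blocks
      from \<open>M0\<close> up to \<open>max M0 n\<close> reach \<open>n\<close>.\<close>
    have "n \<le> N n" using N by (rule strict_mono_imp_increasing)
    then have "M0 \<le> max M0 n" "n \<le> N (max M0 n)"
      using monoD[OF strict_mono_mono[OF N], of n "max M0 n"] by auto
    then have "cmod (\<Sum>k=p..<n. s k t) \<le> (C * x) * sum w' {M0..<max M0 n} + (\<Sum>k=p..<n. \<rho> k)"
      unfolding w'_def using p x C bd[of _ _ t]
      by (intro sum_bound_over_blocks a mono l0 strict_mono_mono[OF N]) (auto simp: x_def mult_ac)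
    also have "(C * x) * sum w' {M0..<max M0 n} \<le> (C * x) * (\<epsilon> / (2 * (C + 1)))"
      using M0[of M0 "max M0 n"] C x by (intro mult_left_mono) auto
    also have "(C * x) * (\<epsilon> / (2 * (C + 1))) = (C / (C + 1)) * (\<epsilon> / 2 * x)"
      using C by (simp add: field_simps)
    also have "\<dots> \<le> 1 * (\<epsilon> / 2 * x)"
      using C x \<epsilon> by (intro mult_right_mono) auto
    also have "(\<Sum>k=p..<n. \<rho> k) \<le> \<epsilon> / 4"
      using p1[of p n] p by auto
    also have "\<epsilon> / 4 \<le> \<epsilon> / 2 * x"
      using mult_left_mono[OF x, of "\<epsilon> / 2"] \<epsilon> by simp
    finally show ?thesis by (simp add: x_def)
  qed
  then show ?thesis by blast
qed

text \<open>The logarithm turns the product into a sum, and a sum of quantities bounded away from 0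
  is dominated by their product. This separates \<open>j\<close>, which supplies the weight in
  \<open>B_norm\<close>, from \<open>\<alpha>\<close>.\<close>

lemma sqrt_ln_mult_bound:
  fixes \<alpha> :: real and j :: int
  shows "sqrt (ln (\<bar>2 * pi * of_int j * \<alpha>\<bar> + 2))
    \<le> 3 * (sqrt (ln (real_of_int \<bar>j\<bar> + 3)) * sqrt (ln (\<bar>\<alpha>\<bar> + 2)))"
proof -
  define u where "u = real_of_int \<bar>j\<bar>"
  define x where "x = ln (u + 3)"
  define y where "y = ln (\<bar>\<alpha>\<bar> + 2)"
  have u0: "u \<ge> 0" by (simp add: u_def)
  have "exp 1 \<le> u + 3" using exp_le u0 by linarith
  then have x: "x \<ge> 1" using u0 by (simp add: x_def ln_ge_iff)
  have "ln 2 \<le> y" by (simp add: y_def)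
  then have y: "y \<ge> 1 / 2" using ln2_ge_two_thirds by linarith
  \<comment> \<open>The cube leaves room for \<open>2 * pi\<close>, crudely replaced by 27, and
    becomes a factor 3 in the logarithm.\<close>
  have u3: "(u + 3) ^ 3 \<ge> 27 * u + 27"
    using u0 by (simp add: power3_eq_cube algebra_simps)
  have "\<bar>2 * pi * of_int j * \<alpha>\<bar> = 2 * pi * u * \<bar>\<alpha>\<bar>"
    by (simp add: u_def abs_mult)
  also have "\<dots> \<le> 27 * u * \<bar>\<alpha>\<bar>"
    using pi_less_4 u0 by (intro mult_right_mono) auto
  finally have "\<bar>2 * pi * of_int j * \<alpha>\<bar> + 2 \<le> (27 * u + 27) * (\<bar>\<alpha>\<bar> + 2)"
    using u0 by (simp add: algebra_simps)
  also have "\<dots> \<le> (u + 3) ^ 3 * (\<bar>\<alpha>\<bar> + 2)"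
    using u3 by (intro mult_right_mono) auto
  finally have "ln (\<bar>2 * pi * of_int j * \<alpha>\<bar> + 2) \<le> ln ((u + 3) ^ 3 * (\<bar>\<alpha>\<bar> + 2))"
    using u0 by (subst ln_le_cancel_iff) (auto intro!: add_nonneg_pos mult_pos_pos)
  also have "\<dots> = 3 * x + y"
    using u0 by (simp add: ln_mult ln_realpow x_def y_def)
  \<comment> \<open>Here \<open>3 * x \<le> 6 * (x * y)\<close> and \<open>y \<le> x * y\<close>; 9
    is a convenient square above 7.\<close>
  also have "\<dots> \<le> 9 * (x * y)"
  proof -
    have "(x - 1) * y \<ge> 0" "x * (y - 1 / 2) \<ge> 0"
      using x y by (auto intro!: mult_nonneg_nonneg)
    moreover have "x * y \<ge> 0" using x y by simp
    ultimately show ?thesis by (simp add: algebra_simps)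
  qed
  finally have "sqrt (ln (\<bar>2 * pi * of_int j * \<alpha>\<bar> + 2)) \<le> sqrt (9 * (x * y))"
    by (rule real_sqrt_le_mono)
  also have "\<dots> = 3 * (sqrt x * sqrt y)"
    by (simp add: real_sqrt_mult)
  finally show ?thesis by (simp add: x_def y_def u_def)
qed

context prob_space
begin

text \<open>Expectation and Fourier series may be interchanged, since the \<open>j\<close>-th term
  has constant modulus \<open>cmod (b j)\<close> and these moduli are summable.\<close>

lemma centered_term_sums:
  fixes b :: "nat \<Rightarrow> complex" and h :: "nat \<Rightarrow> real"
  assumes [measurable]: "random_variable borel (X k)"
    and b: "summable (\<lambda>j. cmod (b j))"
    and f: "\<And>x. (\<lambda>j. b j * iexp (h j * x)) sums f x"
  shows "(\<lambda>j. b j * (a k * centered_iexp M (X k) (h j * \<alpha>) \<omega>)) sums centered_term M X a f \<omega> \<alpha> k"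
proof -
  define g where "g j w = b j * iexp ((h j * \<alpha>) * X k w)" for j w
  have g: "(\<lambda>j. g j w) sums f (\<alpha> * X k w)" for w
    using f[of "\<alpha> * X k w"] by (simp add: g_def mult.assoc)
  have int: "integrable M (g j)" for j
    unfolding g_def[abs_def] by (intro integrable_mult_right integrable_iexp_mult) simp
  have ng: "cmod (g j w) = cmod (b j)" for j w
    by (simp add: g_def norm_mult)
  have "(\<lambda>j. integral\<^sup>L M (g j)) sums (\<integral>w. (\<Sum>j. g j w) \<partial>M)"
    by (rule sums_integral) (use b int in \<open>auto simp: ng prob_space\<close>)
  moreover have "(\<Sum>j. g j w) = f (\<alpha> * X k w)" for w
    using g by (simp add: sums_iff)
  moreover have "integral\<^sup>L M (g j) = b j * (CLINT w|M. iexp ((h j * \<alpha>) * X k w))" for j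
    unfolding g_def by simp
  ultimately have "(\<lambda>j. b j * (CLINT w|M. iexp ((h j * \<alpha>) * X k w))) sums (\<integral>w. f (\<alpha> * X k w) \<partial>M)"
    by simp
  from sums_mult[OF sums_diff[OF g[of \<omega>] this], of "a k"] show ?thesis
    unfolding centered_term_def centered_iexp_def g_def
    by (simp only: right_diff_distrib mult.left_commute[of "a k"])
qed

end

subsection \<open>From exponentials to absolutely convergent Fourier series\<close>

text \<open>Collects what is to be shown about one function for a fixed outcome and constant, so
  that it can stand under the almost sure quantifier.\<close>

definition controlled_series ::
  "'w measure \<Rightarrow> (nat \<Rightarrow> 'w \<Rightarrow> real) \<Rightarrow> (nat \<Rightarrow> complex) \<Rightarrow> 'w \<Rightarrow> real \<Rightarrow> (real \<Rightarrow> complex) \<Rightarrow> bool" where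
  "controlled_series M X a \<omega> C f \<longleftrightarrow>
        (\<forall>\<alpha>. summable (centered_term M X a f \<omega> \<alpha>))
      \<and> continuous_on UNIV (centered_series M X a f \<omega>)
      \<and> (\<forall>K. compact K \<longrightarrow>
           uniform_limit K (\<lambda>n \<alpha>. \<Sum>k<n. centered_term M X a f \<omega> \<alpha> k)
             (centered_series M X a f \<omega>) sequentially)
      \<and> (\<forall>\<alpha>. cmod (centered_series M X a f \<omega> \<alpha>)
               \<le> C * B_norm f * sqrt (ln (\<bar>\<alpha>\<bar> + 2)))"

text \<open>Enumerating the integers by \<open>int_decode\<close> turns the unordered Fourier sums
  into ordinary series, suited to termwise integration and the Weierstrass test.\<close>

lemma B_space_series:
  assumes "f \<in> B_space"
  defines "b \<equiv> \<lambda>j. fourier_coeff f (int_decode j)"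
  shows "(\<lambda>j. cmod (b j) * sqrt (ln (real_of_int \<bar>int_decode j\<bar> + 3))) sums B_norm f"
    and "summable (\<lambda>j. cmod (b j))"
    and "(\<lambda>j. b j * iexp (2 * pi * of_int (int_decode j) * x)) sums f x"
proof -
  have "(\<lambda>j::int. cmod (fourier_coeff f j) * sqrt (ln (real_of_int \<bar>j\<bar> + 3))) summable_on UNIV"
    using assms by (simp add: B_space_def)
  then have "((\<lambda>j::int. cmod (fourier_coeff f j) * sqrt (ln (real_of_int \<bar>j\<bar> + 3))) has_sum B_norm f) UNIV"
    unfolding B_norm_def by (rule has_sum_infsum)
  then have "((\<lambda>j. cmod (b j) * sqrt (ln (real_of_int \<bar>int_decode j\<bar> + 3))) has_sum B_norm f) UNIV"
    unfolding b_def by (subst has_sum_reindex_bij_betw[OF bij_int_decode])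
  then show sums: "(\<lambda>j. cmod (b j) * sqrt (ln (real_of_int \<bar>int_decode j\<bar> + 3))) sums B_norm f"
    by (rule has_sum_imp_sums)
  have "cmod (b j) \<le> cmod (b j) * sqrt (ln (real_of_int \<bar>int_decode j\<bar> + 3))" for j
  proof -
    \<comment> \<open>As \<open>exp 1 \<le> 3\<close>, every weight is at least 1, so the Fourier
      series converges absolutely.\<close>
    have "exp 1 \<le> real_of_int \<bar>int_decode j\<bar> + 3"
      using exp_le by linarith
    then have "1 \<le> ln (real_of_int \<bar>int_decode j\<bar> + 3)"
      by (subst ln_ge_iff) auto
    then show ?thesis by (simp add: mult_le_cancel_left1)
  qed
  then show "summable (\<lambda>j. cmod (b j))"
    by (intro summable_comparison_test'[OF sums_summable[OF sums], of 0]) auto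
  have "((\<lambda>j::int. fourier_coeff f j * exp (2 * \<i> * of_real pi * of_real x * of_int j)) has_sum f x) UNIV"
    using assms by (simp add: B_space_def)
  then have "((\<lambda>j. b j * exp (2 * \<i> * of_real pi * of_real x * of_int (int_decode j))) has_sum f x) UNIV"
    unfolding b_def by (subst has_sum_reindex_bij_betw[OF bij_int_decode])
  from has_sum_imp_sums[OF this] show "(\<lambda>j. b j * iexp (2 * pi * of_int (int_decode j) * x)) sums f x"
    by (simp add: mult_ac)
qed

section \<open>Convergence, continuity and growth for functions in \<open>B_space\<close>\<close>

context prob_space
begin

text \<open>Each Fourier mode is bounded at the frequency \<open>h j * \<alpha>\<close>, and
  separating the logarithm there produces exactly the weights of \<open>B_norm\<close>. It serves
  both for tails, giving convergence, and for partial sums, giving the final bound.\<close>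

lemma sum_centered_term_le:
  assumes rv: "\<And>k. random_variable borel (X k)" and f: "f \<in> B_space"
    and K: "\<And>t. cmod (\<Sum>k\<in>I. a k * centered_iexp M (X k) t \<omega>) \<le> K * sqrt (ln (\<bar>t\<bar> + 2))"
  shows "cmod (\<Sum>k\<in>I. centered_term M X a f \<omega> \<alpha> k) \<le> 3 * K * B_norm f * sqrt (ln (\<bar>\<alpha>\<bar> + 2))"
proof -
  define b where "b j = fourier_coeff f (int_decode j)" for j
  define h where "h j = 2 * pi * of_int (int_decode j)" for j
  define S where "S t = (\<Sum>k\<in>I. a k * centered_iexp M (X k) t \<omega>)" for t
  note B = B_space_series[OF f, folded b_def h_def]
  \<comment> \<open>The instance \<open>t = 0\<close> of the hypothesis forces \<open>K\<close> to
    be nonnegative.\<close>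
  have "0 \<le> K * sqrt (ln (\<bar>0\<bar> + 2))" using K norm_ge_zero order_trans by blast
  then have K0: "K \<ge> 0" by (simp add: zero_le_mult_iff)
  have "(\<lambda>j. \<Sum>k\<in>I. b j * (a k * centered_iexp M (X k) (h j * \<alpha>) \<omega>))
      sums (\<Sum>k\<in>I. centered_term M X a f \<omega> \<alpha> k)"
    by (intro sums_sum centered_term_sums rv B)
  then have sums: "(\<lambda>j. b j * S (h j * \<alpha>)) sums (\<Sum>k\<in>I. centered_term M X a f \<omega> \<alpha> k)"
    by (simp add: S_def sum_distrib_left)
  have le: "cmod (b j * S (h j * \<alpha>))
      \<le> (3 * K * sqrt (ln (\<bar>\<alpha>\<bar> + 2))) * (cmod (b j) * sqrt (ln (real_of_int \<bar>int_decode j\<bar> + 3)))" for j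
  proof -
    have "cmod (S (h j * \<alpha>)) \<le> K * sqrt (ln (\<bar>h j * \<alpha>\<bar> + 2))"
      using K by (simp add: S_def)
    also have "\<dots> \<le> K * (3 * (sqrt (ln (real_of_int \<bar>int_decode j\<bar> + 3)) * sqrt (ln (\<bar>\<alpha>\<bar> + 2))))"
      unfolding h_def by (intro mult_left_mono sqrt_ln_mult_bound K0)
    finally have "cmod (b j) * cmod (S (h j * \<alpha>))
      \<le> cmod (b j) * (K * (3 * (sqrt (ln (real_of_int \<bar>int_decode j\<bar> + 3)) * sqrt (ln (\<bar>\<alpha>\<bar> + 2)))))"
      by (rule mult_left_mono) simp
    then show ?thesis by (simp add: norm_mult mult_ac)
  qed
  have "cmod (\<Sum>k\<in>I. centered_term M X a f \<omega> \<alpha> k) \<le> (3 * K * sqrt (ln (\<bar>\<alpha>\<bar> + 2))) * B_norm f"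
    using norm_suminf_le[OF le sums_summable[OF sums_mult[OF B(1)]]] sums sums_mult[OF B(1)]
    by (simp add: sums_iff)
  then show ?thesis by (simp add: mult_ac)
qed

lemma continuous_centered_term:
  assumes rv: "\<And>k. random_variable borel (X k)" and f: "f \<in> B_space"
  shows "continuous_on A (\<lambda>\<alpha>. centered_term M X a f \<omega> \<alpha> k)"
proof -
  define b where "b j = fourier_coeff f (int_decode j)" for j
  define h where "h j = 2 * pi * of_int (int_decode j)" for j
  define u where "u j \<alpha> = b j * (a k * centered_iexp M (X k) (h j * \<alpha>) \<omega>)" for j \<alpha>
  note B = B_space_series[OF f, folded b_def h_def]
  have sums: "(\<lambda>j. u j \<alpha>) sums centered_term M X a f \<omega> \<alpha> k" for \<alpha>
    unfolding u_def by (intro centered_term_sums rv B)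
  have "uniform_limit A (\<lambda>n \<alpha>. \<Sum>j<n. u j \<alpha>) (\<lambda>\<alpha>. \<Sum>j. u j \<alpha>) sequentially"
  proof (rule Weierstrass_m_test)
    show "cmod (u j \<alpha>) \<le> cmod (b j) * (cmod (a k) * 2)" for j \<alpha>
      unfolding u_def norm_mult by (intro mult_left_mono cmod_centered_iexp_le rv) auto
    show "summable (\<lambda>j. cmod (b j) * (cmod (a k) * 2))"
      by (intro summable_mult2 B)
  qed
  moreover have "(\<Sum>j. u j \<alpha>) = centered_term M X a f \<omega> \<alpha> k" for \<alpha>
    using sums by (simp add: sums_iff)
  moreover have "continuous_on A (u j)" for j
    unfolding u_def
    by (intro continuous_intros continuous_on_compose2[OF continuous_centered_iexp[OF rv, where A = UNIV]]) auto
  ultimately show ?thesis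
    by (intro uniform_limit_theorem[where F = sequentially and f = "\<lambda>n \<alpha>. \<Sum>j<n. u j \<alpha>"])
      (auto intro!: always_eventually continuous_on_sum)
qed

text \<open>Everything about \<open>f\<close> is deduced from one property of the exponentials, so
  the constant depends on the outcome only.\<close>

lemma controlled_series_of_Cauchy:
  assumes rv: "\<And>k. random_variable borel (X k)"
    and Cauchy: "\<And>\<epsilon>. \<epsilon> > 0 \<Longrightarrow> \<exists>p0. \<forall>p n t. p0 \<le> p \<longrightarrow> p \<le> n \<longrightarrow>
      cmod (\<Sum>k=p..<n. a k * centered_iexp M (X k) t \<omega>) \<le> \<epsilon> * sqrt (ln (\<bar>t\<bar> + 2))"
  shows "\<exists>C>0. \<forall>f\<in>B_space. controlled_series M X a \<omega> C f"
proof -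
  define S where "S p n t = (\<Sum>k=p..<n. a k * centered_iexp M (X k) t \<omega>)" for p n t
  obtain p1 where p1: "\<And>p n t. p1 \<le> p \<Longrightarrow> p \<le> n \<Longrightarrow> cmod (S p n t) \<le> 1 * sqrt (ln (\<bar>t\<bar> + 2))"
    using Cauchy[of 1] unfolding S_def by auto
  \<comment> \<open>Tolerance 1 handles the range from \<open>p1\<close> on. Before it each centered
    exponential has modulus at most 2, and \<open>sqrt_ln_ge_half\<close> turns this 2 into
    4.\<close>
  define C where "C = 1 + 4 * (\<Sum>k<p1. cmod (a k))"
  have C: "C \<ge> 1" by (simp add: C_def sum_nonneg)
  have small: "cmod (\<Sum>k\<in>I. a k * centered_iexp M (X k) t \<omega>)
      \<le> 4 * (\<Sum>k<p1. cmod (a k)) * sqrt (ln (\<bar>t\<bar> + 2))" if "I \<subseteq> {..<p1}" for I t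
  proof -
    have "cmod (\<Sum>k\<in>I. a k * centered_iexp M (X k) t \<omega>) \<le> (\<Sum>k\<in>I. cmod (a k) * 2)"
      unfolding norm_mult by (intro sum_norm_le) (simp add: norm_mult mult_left_mono cmod_centered_iexp_le rv)
    also have "\<dots> \<le> (\<Sum>k<p1. cmod (a k) * 2)"
      using that by (intro sum_mono2) auto
    also have "\<dots> = 4 * (\<Sum>k<p1. cmod (a k)) * (1 / 2)"
      by (simp add: sum_distrib_right[symmetric])
    also have "\<dots> \<le> 4 * (\<Sum>k<p1. cmod (a k)) * sqrt (ln (\<bar>t\<bar> + 2))"
      by (intro mult_left_mono sqrt_ln_ge_half) (simp add: sum_nonneg)
    finally show ?thesis .
  qed
  have bound: "cmod (\<Sum>k<n. a k * centered_iexp M (X k) t \<omega>) \<le> C * sqrt (ln (\<bar>t\<bar> + 2))" for n t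
  proof (cases "n \<le> p1")
    case True
    have "cmod (\<Sum>k<n. a k * centered_iexp M (X k) t \<omega>) \<le> (C - 1) * sqrt (ln (\<bar>t\<bar> + 2))"
      using small[of "{..<n}" t] True by (simp add: C_def)
    then show ?thesis
      using sqrt_ln_ge_half[of t] by (simp add: algebra_simps)
  next
    case False
    then have "(\<Sum>k<n. a k * centered_iexp M (X k) t \<omega>)
        = (\<Sum>k<p1. a k * centered_iexp M (X k) t \<omega>) + S p1 n t"
      unfolding S_def lessThan_atLeast0 by (subst sum.atLeastLessThan_concat) auto
    then have "cmod (\<Sum>k<n. a k * centered_iexp M (X k) t \<omega>)
      \<le> (C - 1) * sqrt (ln (\<bar>t\<bar> + 2)) + 1 * sqrt (ln (\<bar>t\<bar> + 2))"
      using small[of "{..<p1}" t] p1[of p1 n t] False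
      by (auto simp: C_def intro!: norm_triangle_le)
    then show ?thesis by (simp add: algebra_simps)
  qed
  show ?thesis
    unfolding controlled_series_def
  proof (intro exI[of _ "3 * C"] conjI ballI)
    fix f assume f: "f \<in> B_space"
    define g where "g = centered_term M X a f \<omega>"
    have B0: "B_norm f \<ge> 0"
      unfolding B_norm_def by (intro infsum_nonneg) auto
    have unif: "\<exists>p0. \<forall>p n \<alpha>. p0 \<le> p \<longrightarrow> p \<le> n \<longrightarrow> \<bar>\<alpha>\<bar> \<le> R \<longrightarrow> cmod (\<Sum>k=p..<n. g \<alpha> k) \<le> e"
      if "e > 0" for e R
    proof -
      \<comment> \<open>The added 1 keeps \<open>D\<close> positive even when
        \<open>B_norm f = 0\<close>. For \<open>\<bar>\<alpha>\<bar> \<le> R\<close> the tolerance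
        \<open>e / D\<close> on exponentials yields \<open>e\<close> for \<open>f\<close>.\<close>
      define D where "D = 3 * (B_norm f + 1) * (sqrt (ln (\<bar>R\<bar> + 2)) + 1)"
      have sq0: "sqrt (ln (\<bar>R\<bar> + 2)) \<ge> 0" using sqrt_ln_ge_half[of R] by linarith
      have D0: "D > 0" unfolding D_def
        by (intro mult_pos_pos) (use B0 sq0 in linarith)+
      then have "e / D > 0" using that by simp
      then obtain p0 where p0: "\<And>p n t. p0 \<le> p \<Longrightarrow> p \<le> n \<Longrightarrow>
          cmod (S p n t) \<le> (e / D) * sqrt (ln (\<bar>t\<bar> + 2))"
        using Cauchy unfolding S_def by blast
      have "cmod (\<Sum>k=p..<n. g \<alpha> k) \<le> e" if p: "p0 \<le> p" "p \<le> n" and \<alpha>: "\<bar>\<alpha>\<bar> \<le> R" for p n \<alpha>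
      proof -
        have "cmod (\<Sum>k=p..<n. g \<alpha> k) \<le> 3 * (e / D) * B_norm f * sqrt (ln (\<bar>\<alpha>\<bar> + 2))"
          unfolding g_def by (intro sum_centered_term_le rv f p0[unfolded S_def] p)
        also have "\<dots> \<le> (e / D) * (3 * (B_norm f + 1) * (sqrt (ln (\<bar>R\<bar> + 2)) + 1))"
        proof -
          have "sqrt (ln (\<bar>\<alpha>\<bar> + 2)) \<le> sqrt (ln (\<bar>R\<bar> + 2))"
            using \<alpha> by (intro real_sqrt_le_mono) simp
          then have "sqrt (ln (\<bar>\<alpha>\<bar> + 2)) \<le> sqrt (ln (\<bar>R\<bar> + 2)) + 1" by linarith
          then have "3 * B_norm f * sqrt (ln (\<bar>\<alpha>\<bar> + 2)) \<le> 3 * (B_norm f + 1) * (sqrt (ln (\<bar>R\<bar> + 2)) + 1)"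
            using B0 sqrt_ln_ge_half[of \<alpha>] by (intro mult_mono) auto
          then have "(e / D) * (3 * B_norm f * sqrt (ln (\<bar>\<alpha>\<bar> + 2))) \<le> (e / D) * (3 * (B_norm f + 1) * (sqrt (ln (\<bar>R\<bar> + 2)) + 1))"
            using \<open>e / D > 0\<close> by (intro mult_left_mono) auto
          then show ?thesis by (simp add: mult_ac)
        qed
        also have "\<dots> = e" using D0 unfolding D_def[symmetric] by simp
        finally show ?thesis .
      qed
      then show ?thesis by blast
    qed
    have summ: "summable (g \<alpha>)" for \<alpha>
      unfolding summable_Cauchy
    proof (intro allI impI)
      fix e :: real assume "e > 0"
      then have "e / 2 > 0" by simp
      from unif[OF this, of "\<bar>\<alpha>\<bar>"] obtain p0 where p0:
        "\<And>p n. p0 \<le> p \<Longrightarrow> p \<le> n \<Longrightarrow> cmod (\<Sum>k=p..<n. g \<alpha> k) \<le> e / 2" by blast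
      have "cmod (sum (g \<alpha>) {m..<n}) < e" if "m \<ge> p0" for m n
        using p0[OF that, of n] \<open>e > 0\<close> by (cases "m \<le> n") auto
      then show "\<exists>N. \<forall>m\<ge>N. \<forall>n. cmod (sum (g \<alpha>) {m..<n}) < e" by blast
    qed
    then show "\<forall>\<alpha>. summable (centered_term M X a f \<omega> \<alpha>)" by (simp add: g_def)
    have lim: "(\<lambda>n. \<Sum>k<n. g \<alpha> k) \<longlonglongrightarrow> centered_series M X a f \<omega> \<alpha>" for \<alpha>
      unfolding centered_series_def g_def[symmetric] by (intro summable_LIMSEQ summ)
    have ul: "uniform_limit K (\<lambda>n \<alpha>. \<Sum>k<n. g \<alpha> k) (centered_series M X a f \<omega>) sequentially"
      if "bounded K" for K
    proof (rule uniform_limitI)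
      fix e :: real assume "e > 0"
      then have e2: "e / 2 > 0" by simp
      obtain R where R: "\<And>\<alpha>. \<alpha> \<in> K \<Longrightarrow> \<bar>\<alpha>\<bar> \<le> R"
        using \<open>bounded K\<close> unfolding bounded_iff real_norm_def by blast
      from unif[OF e2, of R] obtain p0 where p0:
        "\<And>p n \<alpha>. p0 \<le> p \<Longrightarrow> p \<le> n \<Longrightarrow> \<bar>\<alpha>\<bar> \<le> R \<Longrightarrow> cmod (\<Sum>k=p..<n. g \<alpha> k) \<le> e / 2" by blast
      have "dist (\<Sum>k<p. g \<alpha> k) (centered_series M X a f \<omega> \<alpha>) < e" if "p \<ge> p0" "\<alpha> \<in> K" for p \<alpha>
      proof -
        \<comment> \<open>Letting \<open>n\<close> tend to infinity preserves only the weak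
          inequality, hence the tolerance \<open>e / 2\<close>.\<close>
        have "(\<lambda>n. cmod ((\<Sum>k<p. g \<alpha> k) - (\<Sum>k<n. g \<alpha> k)))
            \<longlonglongrightarrow> cmod ((\<Sum>k<p. g \<alpha> k) - centered_series M X a f \<omega> \<alpha>)"
          by (intro tendsto_intros lim)
        moreover have "cmod ((\<Sum>k<p. g \<alpha> k) - (\<Sum>k<n. g \<alpha> k)) \<le> e / 2" if "n \<ge> p" for n
        proof -
          have "(\<Sum>k<n. g \<alpha> k) = (\<Sum>k<p. g \<alpha> k) + (\<Sum>k=p..<n. g \<alpha> k)"
            using that unfolding lessThan_atLeast0 by (subst sum.atLeastLessThan_concat) auto
          then show ?thesis
            using p0[OF \<open>p \<ge> p0\<close> that R[OF \<open>\<alpha> \<in> K\<close>]] by simp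
        qed
        ultimately have "cmod ((\<Sum>k<p. g \<alpha> k) - centered_series M X a f \<omega> \<alpha>) \<le> e / 2"
          by (intro LIMSEQ_le_const2) auto
        then show ?thesis using \<open>e > 0\<close> by (simp add: dist_norm)
      qed
      then show "\<forall>\<^sub>F n in sequentially. \<forall>\<alpha>\<in>K. dist (\<Sum>k<n. g \<alpha> k) (centered_series M X a f \<omega> \<alpha>) < e"
        unfolding eventually_sequentially by blast
    qed
    then show "\<forall>K. compact K \<longrightarrow> uniform_limit K (\<lambda>n \<alpha>. \<Sum>k<n. centered_term M X a f \<omega> \<alpha> k)
             (centered_series M X a f \<omega>) sequentially"
      by (simp add: g_def compact_imp_bounded)
    \<comment> \<open>Continuity is local, so uniform convergence on a closed ball around each point
      suffices.\<close>
    show "continuous_on UNIV (centered_series M X a f \<omega>)"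
    proof (rule continuous_at_imp_continuous_on, intro ballI)
      fix \<alpha> :: real
      have "continuous_on (cball \<alpha> 1) (centered_series M X a f \<omega>)"
        by (rule uniform_limit_theorem[OF _ ul])
          (auto simp: g_def intro!: always_eventually continuous_on_sum continuous_centered_term rv f)
      then show "isCont (centered_series M X a f \<omega>) \<alpha>"
        by (rule continuous_on_interior) simp
    qed
    show "\<forall>\<alpha>. cmod (centered_series M X a f \<omega> \<alpha>) \<le> 3 * C * B_norm f * sqrt (ln (\<bar>\<alpha>\<bar> + 2))"
    proof
      fix \<alpha>
      have "cmod (\<Sum>k<n. g \<alpha> k) \<le> 3 * C * B_norm f * sqrt (ln (\<bar>\<alpha>\<bar> + 2))" for n
        unfolding g_def by (intro sum_centered_term_le rv f bound)
      then show "cmod (centered_series M X a f \<omega> \<alpha>) \<le> 3 * C * B_norm f * sqrt (ln (\<bar>\<alpha>\<bar> + 2))"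
        by (intro LIMSEQ_le_const2[OF tendsto_norm[OF lim]]) auto
    qed
  qed (use C in simp)
qed

end

subsection \<open>The weight condition and the moment conditions\<close>

definition sq_tail :: "(nat \<Rightarrow> complex) \<Rightarrow> nat \<Rightarrow> real" where
  "sq_tail a n = (\<Sum>k. (cmod (a (n + k)))\<^sup>2)"

lemma sq_tail_nonneg:
  assumes "summable (\<lambda>k. (cmod (a k))\<^sup>2)"
  shows "sq_tail a n \<ge> 0"
  using summable_ignore_initial_segment[OF assms, of n]
  unfolding sq_tail_def by (intro suminf_nonneg) (auto simp: add.commute)

lemma sq_tail_Suc_le:
  assumes "summable (\<lambda>k. (cmod (a k))\<^sup>2)"
  shows "sq_tail a (Suc n) \<le> sq_tail a n"
proof -
  have "summable (\<lambda>k. (cmod (a (n + k)))\<^sup>2)"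
    using summable_ignore_initial_segment[OF assms, of n] by (simp add: add.commute)
  from suminf_split_head[OF this] show ?thesis
    by (simp add: sq_tail_def)
qed

lemma antimono_sq_tail:
  assumes "summable (\<lambda>k. (cmod (a k))\<^sup>2)"
  shows "antimono (sq_tail a)"
  using sq_tail_Suc_le[OF assms] by (intro decseq_SucI)

lemma tail_condition_summable:
  assumes "tail_condition a c"
  shows "summable (\<lambda>n. sqrt (sq_tail a n) / (real n * c n))"
proof -
  have "(\<lambda>n. sqrt (sq_tail a n) / (real n * c n)) summable_on {1..}"
    using assms by (simp add: tail_condition_def sq_tail_def)
  \<comment> \<open>The added index 0 contributes 0, since division by 0 yields 0.\<close>
  then have "(\<lambda>n. sqrt (sq_tail a n) / (real n * c n)) summable_on UNIV"
    by (rule summable_on_cong_neutral[THEN iffD1, rotated -1]) (auto simp: not_le)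
  then show ?thesis by (rule summable_on_imp_summable)
qed

text \<open>Condensing once replaces \<open>n\<close> by \<open>2 ^ r\<close> and cancels the factor
  \<open>n\<close>, leaving a denominator of order \<open>sqrt r\<close>. Condensing again, with
  \<open>r = 2 ^ m\<close>, leaves the tail at \<open>2 ^ 2 ^ m\<close> times the square root of
  \<open>2 ^ m\<close>, which is also the order of the block weight.\<close>

lemma summable_dyadic_polynomial:
  assumes tail: "tail_condition a c" and c: "\<And>n. n \<ge> 1 \<Longrightarrow> c n = 1 + sqrt (ln (real n))"
    and D: "D \<ge> 0"
  shows "summable (\<lambda>m. sqrt (sq_tail a (2 ^ 2 ^ m)) * sqrt (D * ln (real (2 ^ 2 ^ Suc m) + 2)))"
proof -
  define T where "T n = sqrt (sq_tail a n)" for n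
  have a: "summable (\<lambda>k. (cmod (a k))\<^sup>2)" using tail by (simp add: tail_condition_def)
  have T0: "T n \<ge> 0" for n using sq_tail_nonneg[OF a] by (simp add: T_def)
  have Tmono: "T n \<le> T m" if "m \<le> n" for m n
    using antimonoD[OF antimono_sq_tail[OF a] that] by (simp add: T_def)
  define f where "f n = T n / (real n * c n)" for n
  have f0: "f n \<ge> 0" for n
    by (cases "n \<ge> 1") (auto simp: f_def c T0 not_le intro!: divide_nonneg_nonneg mult_nonneg_nonneg add_nonneg_nonneg)
  have "summable f" using tail_condition_summable[OF tail] by (simp add: f_def[abs_def] T_def)
  moreover have "f (Suc m) \<le> f m" if "0 < m" for m
    using that unfolding f_def
    by (intro frac_le) (auto simp: c T0 Tmono intro!: mult_mono mult_pos_pos add_pos_nonneg add_nonneg_nonneg)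
  ultimately have "summable (\<lambda>n. 2 ^ n * f (2 ^ n))"
    using condensation_test[of f] f0 by blast
  define g where "g r = T (2 ^ r) / (1 + sqrt (real r * ln 2))" for r :: nat
  have "2 ^ n * f (2 ^ n) = g n" for n
    by (simp add: f_def g_def c ln_realpow)
  with \<open>summable (\<lambda>n. 2 ^ n * f (2 ^ n))\<close> have "summable g" by simp
  moreover have g0: "g n \<ge> 0" for n
    by (auto simp: g_def T0 intro!: divide_nonneg_nonneg add_nonneg_nonneg)
  moreover have "g (Suc m) \<le> g m" for m
    unfolding g_def
    by (intro frac_le) (auto simp: T0 Tmono intro!: mult_mono add_pos_nonneg)
  ultimately have sg: "summable (\<lambda>m. 2 ^ m * g (2 ^ m))"
    using condensation_test[of g] by blast
  have "T (2 ^ 2 ^ m) * sqrt (D * ln (real (2 ^ 2 ^ Suc m) + 2)) \<le> 2 * sqrt (3 * D) * (2 ^ m * g (2 ^ m))" for m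
  proof -
    define x where "x = (2 :: real) ^ m"
    have x: "x \<ge> 1" by (simp add: x_def)
    have ln2: "ln (2 :: real) \<le> 1" using ln_2_less_1 by simp
    have "(2 :: real) ^ 1 \<le> 2 ^ 2 ^ Suc m" by (rule power_increasing) auto
    then have "real (2 ^ 2 ^ Suc m) + 2 \<le> 2 * 2 ^ 2 ^ Suc m" by simp
    then have "ln (real (2 ^ 2 ^ Suc m) + 2) \<le> ln (2 * 2 ^ 2 ^ Suc m)"
      by (subst ln_le_cancel_iff) (auto intro!: add_nonneg_pos)
    also have "\<dots> = (1 + 2 * x) * ln 2"
      by (simp add: ln_mult ln_realpow x_def algebra_simps)
    also have "\<dots> \<le> (3 * x) * 1"
      using x ln2 by (intro mult_mono) auto
    finally have "sqrt (D * ln (real (2 ^ 2 ^ Suc m) + 2)) \<le> sqrt (D * (3 * x))"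
      using D by (intro real_sqrt_le_mono mult_left_mono) auto
    also have "\<dots> = sqrt (3 * D) * sqrt x" by (simp add: real_sqrt_mult)
    finally have 1: "sqrt (D * ln (real (2 ^ 2 ^ Suc m) + 2)) \<le> sqrt (3 * D) * sqrt x" .
    \<comment> \<open>The denominator is at most \<open>2 * sqrt x\<close>, so its summand 1 costs
      only a constant factor.\<close>
    have 2: "sqrt x \<le> 2 * (x / (1 + sqrt (x * ln 2)))"
    proof -
      have "sqrt (x * ln 2) \<le> sqrt x" using x ln2 by (simp add: mult_le_cancel_left1)
      moreover have "1 \<le> sqrt x" using x by simp
      ultimately have "1 + sqrt (x * ln 2) \<le> 2 * sqrt x" by linarith
      then have "sqrt x * (1 + sqrt (x * ln 2)) \<le> sqrt x * (2 * sqrt x)"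
        using x by (intro mult_left_mono) auto
      also have "\<dots> = 2 * x" using x by simp
      finally show ?thesis
        using x by (subst mult.commute) (simp add: pos_le_divide_eq add_pos_nonneg mult.commute)
    qed
    have "sqrt (D * ln (real (2 ^ 2 ^ Suc m) + 2)) \<le> sqrt (3 * D) * (2 * (x / (1 + sqrt (x * ln 2))))"
      by (rule order_trans[OF 1 mult_left_mono[OF 2]]) (use D in simp)
    then have "T (2 ^ 2 ^ m) * sqrt (D * ln (real (2 ^ 2 ^ Suc m) + 2))
       \<le> T (2 ^ 2 ^ m) * (sqrt (3 * D) * (2 * (x / (1 + sqrt (x * ln 2)))))"
      by (rule mult_left_mono[OF _ T0])
    also have "\<dots> = 2 * sqrt (3 * D) * (2 ^ m * g (2 ^ m))"
      by (simp add: g_def x_def)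
    finally show ?thesis .
  qed
  then show ?thesis
    unfolding T_def[symmetric]
    by (intro summable_comparison_test'[OF summable_mult[OF sg, of "2 * sqrt (3 * D)"], of 0])
      (auto simp: abs_mult T0 D)
qed

text \<open>One condensation suffices: \<open>n * c n\<close> is the increasing power
  \<open>n powr (1 - \<gamma> / 2)\<close>, and the condensed term is the tail at
  \<open>2 ^ m\<close> times \<open>(2 ^ m) powr (\<gamma> / 2)\<close>, the order of the block
  weight.\<close>

lemma summable_dyadic_subexponential:
  assumes tail: "tail_condition a c" and c: "\<And>n. n \<ge> 1 \<Longrightarrow> c n = real n powr (- \<gamma> / 2)"
    and \<gamma>: "\<gamma> \<in> {0<..<1}" and D: "D \<ge> 0"
  shows "summable (\<lambda>m. sqrt (sq_tail a (2 ^ m)) * sqrt (D * (real (2 ^ Suc m) + 2) powr \<gamma>))"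
proof -
  define T where "T n = sqrt (sq_tail a n)" for n
  have a: "summable (\<lambda>k. (cmod (a k))\<^sup>2)" using tail by (simp add: tail_condition_def)
  have T0: "T n \<ge> 0" for n using sq_tail_nonneg[OF a] by (simp add: T_def)
  have Tmono: "T n \<le> T m" if "m \<le> n" for m n
    using antimonoD[OF antimono_sq_tail[OF a] that] by (simp add: T_def)
  define f where "f n = T n / (real n * c n)" for n
  have f0: "f n \<ge> 0" for n
    by (cases "n \<ge> 1") (auto simp: f_def c T0 not_le)
  have nc: "real n * c n = real n powr (1 - \<gamma> / 2)" if "n \<ge> 1" for n
    using that powr_add[of "real n" 1 "- \<gamma> / 2"] by (simp add: c)
  have "summable f" using tail_condition_summable[OF tail] by (simp add: f_def[abs_def] T_def)
  moreover have "f (Suc m) \<le> f m" if "0 < m" for m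
    using that \<gamma> unfolding f_def
    by (subst (1 2) nc) (auto simp: T0 Tmono intro!: frac_le powr_mono2)
  ultimately have sf: "summable (\<lambda>n. 2 ^ n * f (2 ^ n))"
    using condensation_test[of f] f0 by blast
  have "T (2 ^ m) * sqrt (D * (real (2 ^ Suc m) + 2) powr \<gamma>) \<le> sqrt (4 * D) * (2 ^ m * f (2 ^ m))" for m
  proof -
    define x where "x = (2 :: real) ^ m"
    have x: "x \<ge> 1" by (simp add: x_def)
    have "(real (2 ^ Suc m) + 2) powr \<gamma> \<le> (4 * x) powr \<gamma>"
      using x \<gamma> by (intro powr_mono2) (auto simp: x_def)
    also have "\<dots> = 4 powr \<gamma> * x powr \<gamma>"
      using x by (simp add: powr_mult)
    also have "\<dots> \<le> 4 * x powr \<gamma>"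
      using \<gamma> powr_mono[of \<gamma> 1 4] by (intro mult_right_mono) auto
    finally have "sqrt (D * (real (2 ^ Suc m) + 2) powr \<gamma>) \<le> sqrt (D * (4 * x powr \<gamma>))"
      using D by (intro real_sqrt_le_mono mult_left_mono) auto
    also have "\<dots> = sqrt (4 * D) * sqrt (x powr \<gamma>)" by (simp add: real_sqrt_mult)
    also have "sqrt (x powr \<gamma>) = x powr (\<gamma> / 2)"
      using x by (simp add: powr_half_sqrt[symmetric] powr_powr)
    finally have "T (2 ^ m) * sqrt (D * (real (2 ^ Suc m) + 2) powr \<gamma>)
       \<le> T (2 ^ m) * (sqrt (4 * D) * x powr (\<gamma> / 2))"
      using T0 by (intro mult_left_mono)
    also have "\<dots> = sqrt (4 * D) * (2 ^ m * f (2 ^ m))"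
      using x by (simp add: f_def c x_def powr_minus field_simps)
    finally show ?thesis .
  qed
  then show ?thesis
    unfolding T_def[symmetric]
    by (intro summable_comparison_test'[OF summable_mult[OF sf, of "sqrt (4 * D)"], of 0])
      (auto simp: abs_mult T0 D)
qed

section \<open>Truncation probabilities and the almost sure statement\<close>

context prob_space
begin

text \<open>Markov's inequality for the moment of order \<open>\<beta>\<close> at level
  \<open>exp (\<beta> * l k)\<close>. The margin \<open>2 * ln (k + 2)\<close> between
  \<open>y k\<close> and \<open>\<beta> * l k\<close> leaves an inverse square, which is
  summable.\<close>

lemma summable_prob_gt_of_moments:
  fixes X :: "nat \<Rightarrow> 'a \<Rightarrow> real" and y l :: "nat \<Rightarrow> real"
  assumes rv: "\<And>k. random_variable borel (X k)" and mom: "moments_bigo M X \<beta> g" and \<beta>: "\<beta> > 0"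
    and g: "\<And>k. \<bar>g k\<bar> \<le> exp (y k)" and y: "\<And>k. y k + 2 * ln (real k + 2) \<le> \<beta> * l k"
  shows "summable (\<lambda>k. prob {\<omega> \<in> space M. \<bar>X k \<omega>\<bar> > exp (l k)})"
proof -
  note rv[measurable]
  obtain C where C: "C > 0"
    and E: "\<forall>\<^sub>F k in sequentially. norm (\<integral>\<omega>. \<bar>X k \<omega>\<bar> powr \<beta> \<partial>M) \<le> C * norm (g k)"
    using mom unfolding moments_bigo_def by (auto elim: landau_o.bigE)
  have int: "\<forall>\<^sub>F k in sequentially. integrable M (\<lambda>\<omega>. \<bar>X k \<omega>\<bar> powr \<beta>)"
    using mom by (simp add: moments_bigo_def)
  have "\<forall>\<^sub>F k in sequentially. norm (prob {\<omega> \<in> space M. \<bar>X k \<omega>\<bar> > exp (l k)}) \<le> C * (1 / (real k + 2)\<^sup>2)"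
    using E int
  proof eventually_elim
    case (elim k)
    have "prob {\<omega> \<in> space M. \<bar>X k \<omega>\<bar> > exp (l k)}
      \<le> prob {\<omega> \<in> space M. \<bar>X k \<omega>\<bar> powr \<beta> \<ge> exp (\<beta> * l k)}"
    proof (rule finite_measure_mono)
      have "exp (\<beta> * l k) \<le> \<bar>X k \<omega>\<bar> powr \<beta>" if "exp (l k) < \<bar>X k \<omega>\<bar>" for \<omega>
        using powr_mono2[of \<beta> "exp (l k)" "\<bar>X k \<omega>\<bar>"] that \<beta> by (simp add: powr_def)
      then show "{\<omega> \<in> space M. \<bar>X k \<omega>\<bar> > exp (l k)} \<subseteq> {\<omega> \<in> space M. \<bar>X k \<omega>\<bar> powr \<beta> \<ge> exp (\<beta> * l k)}"
        by auto
    qed measurable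
    also have "\<dots> \<le> (\<integral>\<omega>. \<bar>X k \<omega>\<bar> powr \<beta> \<partial>M) / exp (\<beta> * l k)"
      by (rule integral_Markov_inequality_measure[where A = "{}"]) (use elim in auto)
    also have "\<dots> \<le> (C * exp (y k)) / exp (\<beta> * l k)"
    proof (rule divide_right_mono)
      have "C * norm (g k) \<le> C * exp (y k)" using g C by (intro mult_left_mono) auto
      with elim(1) show "(\<integral>\<omega>. \<bar>X k \<omega>\<bar> powr \<beta> \<partial>M) \<le> C * exp (y k)" by simp
    qed simp
    also have "\<dots> = C * exp (y k - \<beta> * l k)" by (simp add: exp_diff)
    also have "\<dots> \<le> C * exp (- (2 * ln (real k + 2)))"
      using C y[of k] by (intro mult_left_mono) auto
    also have "exp (- (2 * ln (real k + 2))) = 1 / (real k + 2)\<^sup>2"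
      by (simp add: exp_minus exp_double divide_inverse)
    finally show ?case by simp
  qed
  moreover have "summable (\<lambda>k. C * (1 / (real k + 2)\<^sup>2))"
  proof (rule summable_mult)
    have "summable (\<lambda>k. 1 / (real (k + 2))\<^sup>2)"
      using summable_ignore_initial_segment[OF inverse_power_summable[of 2, where ?'a = real], of 2]
      by (simp add: inverse_eq_divide)
    then show "summable (\<lambda>k. 1 / (real k + 2)\<^sup>2)" by (simp add: add.commute)
  qed
  ultimately show ?thesis by (rule summable_comparison_test_ev)
qed

text \<open>Chance enters only through the bound on exponentials; what follows is deterministic for
  a fixed outcome. The exceptional null set therefore serves all \<open>f\<close> and
  \<open>\<alpha>\<close>.\<close>

lemma AE_controlled_series:
  fixes a :: "nat \<Rightarrow> complex" and l :: "nat \<Rightarrow> real"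
  assumes indep: "indep_vars (\<lambda>_. borel) X UNIV"
    and l: "\<And>n. ln (real n + 2) \<le> l n" and mono: "mono l"
    and tail: "summable (\<lambda>k. prob {\<omega> \<in> space M. \<bar>X k \<omega>\<bar> > exp (l k)})"
    and a: "summable (\<lambda>k. (cmod (a k))\<^sup>2)" and N: "strict_mono N"
    and w: "summable (\<lambda>m. sqrt (sq_tail a (N m)) * sqrt (l (N (Suc m))))"
  shows "AE \<omega> in M. \<exists>C>0. \<forall>f\<in>B_space. controlled_series M X a \<omega> C f"
proof -
  have rv: "random_variable borel (X k)" for k
    using indep unfolding indep_vars_def by auto
  \<comment> \<open>Square summability supplies the uniform bound on the coefficients used in the
    truncation estimate.\<close>
  have "cmod (a k) \<le> sqrt (\<Sum>k. (cmod (a k))\<^sup>2)" for k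
    using sum_le_suminf[OF a, of "{k}"] by (intro real_le_rsqrt) auto
  from AE_sum_bound_truncated[where a = a, OF indep l mono tail this] show ?thesis
  proof eventually_elim
    case (elim \<omega>)
    then obtain C \<rho> where C: "C \<ge> 0" and \<rho>: "summable \<rho>" and bd: "\<And>p n t. p \<le> n \<Longrightarrow>
      cmod (\<Sum>k=p..<n. a k * centered_iexp M (X k) t \<omega>)
      \<le> C * (L2_set (\<lambda>k. cmod (a k)) {p..<n} * sqrt (l n) * sqrt (ln (\<bar>t\<bar> + 2))) + (\<Sum>k=p..<n. \<rho> k)"
      by blast
    have l0: "l n \<ge> 0" for n
      using l[of n] ln_ge_zero[of "real n + 2"] by linarith
    show ?case
      by (intro controlled_series_of_Cauchy rv
            uniformly_Cauchy_of_blocks[OF bd C \<rho> a mono l0 N w[unfolded sq_tail_def]])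
  qed
qed

end

section \<open>Choice of truncation levels and blocks in the two cases\<close>

theorem theorem1p4:
  fixes M :: "'w measure" and X :: "nat \<Rightarrow> 'w \<Rightarrow> real"
    and a :: "nat \<Rightarrow> complex" and c :: "nat \<Rightarrow> real"
  assumes "prob_space M"
    and "prob_space.indep_vars M (\<lambda>_. borel) X UNIV"
    and "(\<exists>\<beta>>0. \<exists>d>0. moments_bigo M X \<beta> (\<lambda>k. real k powr d)
            \<and> (\<forall>n\<ge>1. c n = 1 + sqrt (ln (real n))))
       \<or> (\<exists>\<beta>>0. \<exists>\<gamma>\<in>{0<..<1}. moments_bigo M X \<beta> (\<lambda>k. 2 powr (real k powr \<gamma>))
            \<and> (\<forall>n\<ge>1. c n = real n powr (- \<gamma> / 2)))"
    and "tail_condition a c"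
  shows "\<exists>\<Omega>\<^sub>0\<in>sets M. measure M \<Omega>\<^sub>0 = 1 \<and>
    (\<forall>\<omega>\<in>\<Omega>\<^sub>0. \<exists>C>0. \<forall>f\<in>B_space. circle_integral f = 0 \<longrightarrow>
        (\<forall>\<alpha>. summable (centered_term M X a f \<omega> \<alpha>))
      \<and> continuous_on UNIV (centered_series M X a f \<omega>)
      \<and> (\<forall>K. compact K \<longrightarrow>
           uniform_limit K (\<lambda>n \<alpha>. \<Sum>k<n. centered_term M X a f \<omega> \<alpha> k)
             (centered_series M X a f \<omega>) sequentially)
      \<and> (\<forall>\<alpha>. cmod (centered_series M X a f \<omega> \<alpha>)
               \<le> C * B_norm f * sqrt (ln (\<bar>\<alpha>\<bar> + 2))))"
proof -
  interpret prob_space M by fact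
  have rv: "random_variable borel (X k)" for k
    using assms(2) unfolding indep_vars_def by auto
  have a: "summable (\<lambda>k. (cmod (a k))\<^sup>2)"
    using assms(4) by (simp add: tail_condition_def)
  obtain l :: "nat \<Rightarrow> real" and N where "\<And>n. ln (real n + 2) \<le> l n" "mono l"
    "summable (\<lambda>k. prob {\<omega> \<in> space M. \<bar>X k \<omega>\<bar> > exp (l k)})" "strict_mono N"
    "summable (\<lambda>m. sqrt (sq_tail a (N m)) * sqrt (l (N (Suc m))))"
    using assms(3)
  proof (elim disjE exE bexE conjE)
    fix \<beta> d :: real
    assume \<beta>: "\<beta> > 0" and d: "d > 0" and mom: "moments_bigo M X \<beta> (\<lambda>k. real k powr d)"
      and c: "\<forall>n\<ge>1. c n = 1 + sqrt (ln (real n))"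
    \<comment> \<open>The summand 1 gives \<open>ln (n + 2) \<le> l n\<close>. The other makes
      \<open>\<beta> * D\<close> at least \<open>d + 2\<close>: \<open>d\<close> for the moment
      growth, 2 for summability.\<close>
    define D where "D = 1 + (d + 2) / \<beta>"
    have D: "D \<ge> 1" using \<beta> d by (simp add: D_def)
    show thesis
    proof (rule that[of "\<lambda>n. D * ln (real n + 2)" "\<lambda>m. 2 ^ 2 ^ m"])
      show "ln (real n + 2) \<le> D * ln (real n + 2)" for n
        using mult_right_mono[OF D, of "ln (real n + 2)"] by simp
      show "mono (\<lambda>n. D * ln (real n + 2))"
        using D by (intro monoI mult_left_mono) auto
      show "summable (\<lambda>k. prob {\<omega> \<in> space M. \<bar>X k \<omega>\<bar> > exp (D * ln (real k + 2))})"
      proof (rule summable_prob_gt_of_moments[OF rv mom \<beta>])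
        fix k
        have "real k powr d \<le> (real k + 2) powr d" using d by (intro powr_mono2) auto
        then show "\<bar>real k powr d\<bar> \<le> exp (d * ln (real k + 2))"
          by (simp add: powr_def split: if_splits)
        have "(d + 2) * ln (real k + 2) \<le> (\<beta> * D) * ln (real k + 2)"
          using \<beta> by (intro mult_right_mono) (auto simp: D_def field_simps)
        then show "d * ln (real k + 2) + 2 * ln (real k + 2) \<le> \<beta> * (D * ln (real k + 2))"
          by (simp add: algebra_simps)
      qed
      show "strict_mono (\<lambda>m. 2 ^ 2 ^ m :: nat)"
        by (intro strict_monoI power_strict_increasing) auto
      show "summable (\<lambda>m. sqrt (sq_tail a (2 ^ 2 ^ m)) * sqrt (D * ln (real (2 ^ 2 ^ Suc m) + 2)))"
        using c D by (intro summable_dyadic_polynomial[OF assms(4)]) auto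
    qed
  next
    fix \<beta> \<gamma> :: real
    assume \<beta>: "\<beta> > 0" and \<gamma>: "\<gamma> \<in> {0<..<1}" and mom: "moments_bigo M X \<beta> (\<lambda>k. 2 powr (real k powr \<gamma>))"
      and c: "\<forall>n\<ge>1. c n = real n powr (- \<gamma> / 2)"
    \<comment> \<open>The summand \<open>1 / \<gamma>\<close> gives
      \<open>ln (n + 2) \<le> l n\<close>. The other makes \<open>\<beta> * D\<close> at least
      \<open>1 + 2 / \<gamma>\<close>: 1 for the moment growth, \<open>2 / \<gamma>\<close> for the
      margin \<open>2 * ln (k + 2)\<close>.\<close>
    define D where "D = (1 + 2 / \<gamma>) / \<beta> + 1 / \<gamma>"
    have D1: "D \<ge> 1 / \<gamma>" and D0: "D \<ge> 0" using \<beta> \<gamma> by (auto simp: D_def)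
    have "\<beta> * D = (1 + 2 / \<gamma>) + \<beta> / \<gamma>" using \<beta> unfolding D_def distrib_left by simp
    then have D2: "1 + 2 / \<gamma> \<le> \<beta> * D" using \<beta> \<gamma> by simp
    have ln_le: "ln (real n + 2) \<le> (1 / \<gamma>) * (real n + 2) powr \<gamma>" for n
      using ln_le_minus_one[of "(real n + 2) powr \<gamma>"] \<gamma> by (simp add: ln_powr field_simps)
    show thesis
    proof (rule that[of "\<lambda>n. D * (real n + 2) powr \<gamma>" "\<lambda>m. 2 ^ m"])
      show "ln (real n + 2) \<le> D * (real n + 2) powr \<gamma>" for n
        using ln_le[of n] mult_right_mono[OF D1, of "(real n + 2) powr \<gamma>"] by simp
      show "mono (\<lambda>n. D * (real n + 2) powr \<gamma>)"
        using D0 \<gamma> by (intro monoI mult_left_mono powr_mono2) auto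
      show "summable (\<lambda>k. prob {\<omega> \<in> space M. \<bar>X k \<omega>\<bar> > exp (D * (real k + 2) powr \<gamma>)})"
      proof (rule summable_prob_gt_of_moments[OF rv mom \<beta>])
        fix k
        have "real k powr \<gamma> * ln 2 \<le> (real k + 2) powr \<gamma> * 1"
          using \<gamma> ln_2_less_1 by (intro mult_mono powr_mono2) auto
        then show "\<bar>2 powr (real k powr \<gamma>)\<bar> \<le> exp ((real k + 2) powr \<gamma>)"
          by (simp add: powr_def[of 2])
        have "(real k + 2) powr \<gamma> + 2 * ln (real k + 2) \<le> (1 + 2 / \<gamma>) * (real k + 2) powr \<gamma>"
          using ln_le[of k] by (simp add: algebra_simps)
        also have "\<dots> \<le> \<beta> * D * (real k + 2) powr \<gamma>"
          using D2 by (intro mult_right_mono) auto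
        finally show "(real k + 2) powr \<gamma> + 2 * ln (real k + 2) \<le> \<beta> * (D * (real k + 2) powr \<gamma>)"
          by (simp add: mult.assoc)
      qed
      show "strict_mono (\<lambda>m. 2 ^ m :: nat)"
        by (intro strict_monoI power_strict_increasing) auto
      show "summable (\<lambda>m. sqrt (sq_tail a (2 ^ m)) * sqrt (D * (real (2 ^ Suc m) + 2) powr \<gamma>))"
        using c D0 \<gamma> by (intro summable_dyadic_subexponential[OF assms(4)]) auto
    qed
  qed
  \<comment> \<open>The set of good outcomes itself is not shown to be measurable; an event of
    probability one inside it is chosen.\<close>
  from AE_E_prob[OF AE_controlled_series[OF assms(2) this(1-3) a this(4,5)]]
  obtain \<Omega>\<^sub>0 where sub: "\<Omega>\<^sub>0 \<subseteq> {\<omega> \<in> space M. \<exists>C>0. \<forall>f\<in>B_space. controlled_series M X a \<omega> C f}"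
    and \<Omega>\<^sub>0: "\<Omega>\<^sub>0 \<in> events" "prob \<Omega>\<^sub>0 = 1" .
  from sub have "\<forall>\<omega>\<in>\<Omega>\<^sub>0. \<exists>C>0. \<forall>f\<in>B_space. circle_integral f = 0 \<longrightarrow> controlled_series M X a \<omega> C f"
    by blast
  then show ?thesis
    unfolding controlled_series_def by (intro bexI[of _ \<Omega>\<^sub>0] conjI \<Omega>\<^sub>0)
qed

end
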